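(* Let $\Sigma\subset\mathbb{R}^{n+1}$ be an axially symmetric, closed, smooth hypersurface with a simply connected interior which is contained inside the unit sphere $\mathbb{S}^{n}$, and let $\Sigma'$ be its singularity set. Let $\mathcal{V}$ be a connected component of $\Sigma\setminus\Sigma'$ which is simply connected and regular. Then the image $\Phi_{\Sigma}(\mathcal{V})$ of $\mathcal{V}$ under the surface map $\Phi_{\Sigma}$ is a space like surface.
   Context: $\mathbb{S}^{n}$ is the unit sphere in $\mathbb{R}^{n+1}$, $e_{n+1}=(0,\dots,0,1)$ is its north pole, and $\mathbb{R}^{+}=[0,\infty)$. **Hypersurfaces.** A hypersurface $\Sigma$ in $\mathbb{R}^{n+1}$ is an $n$-dimensional set which is the solution set of an equation $F(x)=0$ for a continuous $F:\mathbb{R}^{n+1}\to\mathbb{R}$; it is smooth if $F$ is continuously differentiable and $\nabla F(x)\neq\bar 0$ whenever $F(x)=0$. A one-dimensional hypersurface is called a curve. "Contained inside $\mathbb{S}^{n}$" means contained in the open unit ball. $\Sigma$ is axially symmetric if it is invariant under the rotations which fix the $x_{n+1}$-axis. For smooth $\Sigma$, $\mathrm{H}_{x}(\Sigma)$ is the tangent hyperplane of $\Sigma$ at $x$. The singularity set $\Sigma'\subset\Sigma$ is the set of $x\in\Sigma$ for which $\mathrm{H}_{x}(\Sigma)$ passes through $e_{n+1}$. **Regularity.** Let $\Gamma$ be a curve in $\mathbb{R}^{2}$. A subcurve (connected subset) $\Gamma^{*}$ of $\Gamma$ is regular if there are an interval $I$ and a twice continuously differentiable $\gamma=(\gamma_1,\gamma_2):I\to\mathbb{R}^{2}$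 parameterizing $\Gamma^{*}$ with $\gamma_{1}'(t)\gamma_{2}''(t)-\gamma_{1}''(t)\gamma_{2}'(t)\neq0$ for all $t\in I$. A connected axially symmetric subdomain of an axially symmetric closed hypersurface is regular if it is the surface of revolution (about the $x_{n+1}$-axis) of a regular subcurve (lying in the plane spanned by $e_1$ and $e_{n+1}$, identified with $\mathbb{R}^2$). **Surface map.** For $\psi\in\mathbb{S}^{n}$ and $\rho\in[0,1)$ with $\rho\neq\psi_{n+1}$ put $$\Psi(\psi,\rho)=\left(\frac{\psi^{*}}{\rho-\psi_{n+1}},\ \frac{\sqrt{1-\rho^{2}}}{|\rho-\psi_{n+1}|}\right)\in\mathbb{R}^{n}\times\mathbb{R}^{+},\qquad \psi^{*}=(\psi_{1},\dots,\psi_{n}).$$ The surface map of $\Sigma$ (closed, smooth, contained inside $\mathbb{S}^{n}$) is $\Phi_{\Sigma}:\Sigma\setminus\Sigma'\to\mathbb{R}^{n+1}$, $\Phi_{\Sigma}(x)=\Psi(\psi_{x},\rho_{x})$, where $\psi_{x}\in\mathbb{S}^{n}$ is the unit normal of $\mathrm{H}_{x}(\Sigma)$ and $\rho_{x}\ge0$ its distance from the origin, the sign of $\psi_{x}$ being chosen so that $\rho_{x}\psi_{x}\in\mathrm{H}_{x}(\Sigma)$ (either sign may be chosen if $\rho_{x}=0$). **Space like.** A smooth, connected hypersurface $S$ in $\mathbb{R}^{n+1}$ is space like if at each $x\in S$ the normal $\mathbf{N}(x)$ of $S$ at $x$ satisfies $\mathbf{N}_{n+1}^{2}(x)\geq\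sum_{i=1}^{n}\mathbf{N}_{i}^{2}(x)$.
   Formalization: Regular is taken to mean that the regular subcurve is the whole section of V by the plane of e_1 and e_{n+1}. This excludes, for n≥3, simply connected V missing the axis, whose image has a double-cone point and is not smooth; for V meeting the axis nothing changes. *)

theory Defs
  imports "HOL-Analysis.Analysis"
begin

text \<open>
  \<open>(real^'n) \<times> real\<close> is Euclidean space of dimension \<open>n + 1\<close> with \<open>n = CARD('n)\<close>; the second
  component is the coordinate \<open>x\<^sub>n\<^sub>+\<^sub>1\<close>, the first one is \<open>x\<^sup>* = (x\<^sub>1, ..., x\<^sub>n)\<close>.
\<close>

definition north_pole :: "(real^'n) \<times> real" where
  "north_pole = (0, 1)"

text \<open>Smooth hypersurfaces. A nonempty regular level set automatically has dimension one less
  than the ambient space, so the dimension requirement amounts to nonemptiness.\<close>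

definition smooth_equation ::
    "('a::euclidean_space \<Rightarrow> real) \<Rightarrow> ('a \<Rightarrow> 'a) \<Rightarrow> 'a set \<Rightarrow> bool" where
  "smooth_equation F G S \<longleftrightarrow>
     (\<forall>x. GDERIV F x :> G x) \<and> continuous_on UNIV G \<and>
     S = {x. F x = 0} \<and> (\<forall>x\<in>S. G x \<noteq> 0)"

definition smooth_hypersurface :: "'a::euclidean_space set \<Rightarrow> bool" where
  "smooth_hypersurface S \<longleftrightarrow> S \<noteq> {} \<and> (\<exists>F G. smooth_equation F G S)"

text \<open>The tangent hyperplane does not depend on the equation: two equations of the same
  smooth hypersurface have parallel gradients at each of its points.\<close>

definition tangent_hyperplane :: "'a::euclidean_space set \<Rightarrow> 'a \<Rightarrow> 'a set" where
  "tangent_hyperplane S x = {y. \<exists>F G. smooth_equation F G S \<and> G x \<bullet> (y - x) = 0}"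

definition unit_normal :: "'a::euclidean_space set \<Rightarrow> 'a \<Rightarrow> 'a \<Rightarrow> bool" where
  "unit_normal S x N \<longleftrightarrow> norm N = 1 \<and> (\<forall>y\<in>tangent_hyperplane S x. N \<bullet> (y - x) = 0)"

definition singularity_set :: "((real^'n) \<times> real) set \<Rightarrow> ((real^'n) \<times> real) set" where
  "singularity_set S = {x \<in> S. north_pole \<in> tangent_hyperplane S x}"

text \<open>The orientation-preserving orthogonal maps of \<open>\<real>\<^sup>n\<^sup>+\<^sup>1\<close> that fix the
  \<open>x\<^sub>n\<^sub>+\<^sub>1\<close>-axis pointwise are the maps \<open>axial_map A\<close> with \<open>A\<close> a rotation matrix of \<open>\<real>\<^sup>n\<close>
  (only the identity if \<open>n = 1\<close>).\<close>

definition axial_map :: "real^'n^'n \<Rightarrow> (real^'n) \<times> real \<Rightarrow> (real^'n) \<times> real" where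
  "axial_map A x = (A *v fst x, snd x)"

definition axially_symmetric :: "((real^'n) \<times> real) set \<Rightarrow> bool" where
  "axially_symmetric S \<longleftrightarrow> (\<forall>A. rotation_matrix A \<longrightarrow> axial_map A ` S = S)"

text \<open>An index type has no distinguished first element, so the coordinate direction that plays
  the role of \<open>e\<^sub>1\<close> is a parameter \<open>k\<close>.\<close>

definition plane_embedding :: "'n \<Rightarrow> real^2 \<Rightarrow> (real^'n) \<times> real" where
  "plane_embedding k p = (axis k (p$1), p$2)"

definition profile :: "'n \<Rightarrow> ((real^'n) \<times> real) set \<Rightarrow> (real^2) set" where
  "profile k S = plane_embedding k -` S"

definition surface_of_revolution :: "'n \<Rightarrow> (real^2) set \<Rightarrow> ((real^'n) \<times> real) set" where
  "surface_of_revolution k C =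
     (\<Union>A\<in>{A. rotation_matrix A}. axial_map A ` plane_embedding k ` C)"

text \<open>The interval may be open, closed or half-open; derivatives at end points that belong to it
  are one-sided. It must not reduce to a point, where the derivatives would be arbitrary.\<close>

definition regular_subcurve :: "(real^2) set \<Rightarrow> (real^2) set \<Rightarrow> bool" where
  "regular_subcurve \<Gamma> C \<longleftrightarrow>
     C \<subseteq> \<Gamma> \<and> connected C \<and>
     (\<exists>I \<gamma> \<gamma>' \<gamma>''.
        is_interval I \<and> interior I \<noteq> {} \<and> \<gamma> ` I = C \<and>
        (\<forall>t\<in>I. (\<gamma> has_vector_derivative \<gamma>' t) (at t within I)) \<and>
        (\<forall>t\<in>I. (\<gamma>' has_vector_derivative \<gamma>'' t) (at t within I)) \<and>
        continuous_on I \<gamma>'' \<and>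
        (\<forall>t\<in>I::real set. \<gamma>' t $ 1 * \<gamma>'' t $ 2 - \<gamma>'' t $ 1 * \<gamma>' t $ 2 \<noteq> 0))"

text \<open>
  The generating subcurve of \<open>V\<close> is its whole section by the plane, not only the half of that
  section on one side of the axis. For a domain \<open>V\<close> of a smooth hypersurface that meets the axis
  this makes no difference, since a regular half joins with its mirror image to a regular curve.
  It excludes the domains generated by an arc off the axis and its mirror image, which are
  diffeomorphic to \<open>S\<^sup>n\<^sup>-\<^sup>1 \<times> (0,1)\<close>. They are not simply connected for \<open>n = 2\<close>, but they are
  for \<open>n \<ge> 3\<close>, and then their image under the surface map can fail to be a manifold:
  where the arc has a horizontal tangent, the whole orbit is mapped to the vertex of a double cone.
\<close>

definition regular_subdomain ::
    "'n \<Rightarrow> ((real^'n) \<times> real) set \<Rightarrow> ((real^'n) \<times> real) set \<Rightarrow> bool" where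
  "regular_subdomain k S V \<longleftrightarrow>
     openin (top_of_set S) V \<and> connected V \<and> axially_symmetric V \<and>
     (\<exists>C. regular_subcurve (profile k S) C \<and> profile k V = C \<and> V = surface_of_revolution k C)"

definition sphere_coords :: "(real^'n) \<times> real \<Rightarrow> real \<Rightarrow> (real^'n) \<times> real" where
  "sphere_coords \<psi> \<rho> =
     (fst \<psi> /\<^sub>R (\<rho> - snd \<psi>), sqrt (1 - \<rho>\<^sup>2) / \<bar>\<rho> - snd \<psi>\<bar>)"

definition tangent_distance :: "((real^'n) \<times> real) set \<Rightarrow> (real^'n) \<times> real \<Rightarrow> real" where
  "tangent_distance S x = infdist 0 (tangent_hyperplane S x)"

text \<open>The choice is unique unless the tangent hyperplane passes through the origin; then there are
  two choices \<open>\<plusminus>\<psi>\<close>, for which \<open>sphere_coords\<close> has the same value.\<close>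

definition tangent_normal ::
    "((real^'n) \<times> real) set \<Rightarrow> (real^'n) \<times> real \<Rightarrow> (real^'n) \<times> real" where
  "tangent_normal S x =
     (SOME \<psi>. unit_normal S x \<psi> \<and> tangent_distance S x *\<^sub>R \<psi> \<in> tangent_hyperplane S x)"

definition surface_map :: "((real^'n) \<times> real) set \<Rightarrow> (real^'n) \<times> real \<Rightarrow> (real^'n) \<times> real" where
  "surface_map S x = sphere_coords (tangent_normal S x) (tangent_distance S x)"

definition space_like :: "((real^'n) \<times> real) set \<Rightarrow> bool" where
  "space_like S \<longleftrightarrow>
     smooth_hypersurface S \<and> connected S \<and>
     (\<forall>x\<in>S. \<forall>N. unit_normal S x N \<longrightarrow> (snd N)\<^sup>2 \<ge> (\<Sum>i\<in>UNIV. (fst N $ i)\<^sup>2))"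

end

theory Submission
  imports Defs
begin

text \<open>
  Write \<open>e\<close> for the north pole. If \<open>\<Sigma> = {F = 0}\<close> with gradient \<open>G\<close>, the tangent hyperplane at a
  nonsingular point \<open>x\<close> is \<open>{y. W \<bullet> (y - e) = 1}\<close> with \<open>W = G x / (G x \<bullet> (x - e))\<close>, its pole with
  respect to the unit sphere around \<open>e\<close>. The surface map sends \<open>x\<close> to \<open>(W\<^sup>*, sqrt (\<bar>W\<^sup>*\<bar>\<^sup>2 - 1 - 2 W\<^sub>n\<^sub>+\<^sub>1))\<close>
  (\<open>surface_map_eq\<close>), so the image of \<open>V\<close> is its polar dual in other coordinates. By duality the
  normal of the dual at \<open>W\<close> is \<open>x - e\<close>. Transported to the new coordinates it is space like exactly
  because \<open>\<bar>x\<bar> \<le> 1\<close> (\<open>slope_identity\<close>), and strictly so because \<open>\<bar>x\<bar> < 1\<close>.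

  What remains is that the image is an embedded closed hypersurface, indeed the entire graph of a
  continuously differentiable function. By symmetry the pole of a tangent hyperplane at a point of
  the generating arc lies in the plane of the arc (\<open>gradient_in_profile_plane\<close>), so one has to study
  the plane curve \<open>(q t, w t)\<close> dual to the arc. The derivative of \<open>q\<close> is the curvature of the arc times
  a nonzero factor, hence \<open>q\<close> is injective (\<open>inj_on_q\<close>). Its range is open, as the interval of
  parameters cannot contain an end point of its own: \<open>V\<close> is open in \<open>\<Sigma>\<close> (\<open>interval_extends\<close>). Its range
  is closed, as \<open>V\<close> is closed in \<open>\<Sigma> - \<Sigma>'\<close> and the poles escape to infinity at \<open>\<Sigma>'\<close>
  (\<open>closed_range_q\<close>). So \<open>q\<close> takes every real value exactly once, and the image of the arc is the graph
  of a function \<open>f\<close> on the line with \<open>\<bar>f'\<bar> < 1\<close> (\<open>image_of_arc_is_graph\<close>).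

  For \<open>n \<ge> 2\<close> the rotations make \<open>f\<close> even, and the image of \<open>V\<close> is the graph of \<open>v \<mapsto> f \<bar>v\<bar>\<close>; for \<open>n = 1\<close>
  there are no rotations, and it is the graph of \<open>f\<close> itself.
\<close>

section \<open>Tangent hyperplanes of level sets\<close>

text \<open>
  For small \<open>s > 0\<close> the equation changes sign between \<open>x + s(T - \<epsilon> G x)\<close> and \<open>x + s(T + \<epsilon> G x)\<close>,
  so the intermediate value theorem supplies a zero on the segment between them. This replaces the
  implicit function theorem: it provides points of \<open>S\<close> on both sides of \<open>x\<close> (take \<open>\<plusminus>T\<close>).
\<close>

lemma level_set_points_in_tangent_direction:
  fixes T :: "'a::euclidean_space"
  assumes FG: "smooth_equation F G S" and x: "x \<in> S" and T: "G x \<bullet> T = 0" and "\<epsilon> > 0"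
  shows "\<exists>d>0. \<forall>s. 0 < s \<and> s < d \<longrightarrow> (\<exists>r. \<bar>r\<bar> \<le> \<epsilon> * s \<and> x + s *\<^sub>R T + r *\<^sub>R G x \<in> S)"
proof -
  have grad: "(F has_derivative (\<lambda>h. h \<bullet> G y)) (at y)" for y
    using FG by (simp add: smooth_equation_def gderiv_def)
  have S: "S = {y. F y = 0}" and "F x = 0" and "G x \<noteq> 0"
    using FG x by (auto simp: smooth_equation_def)
  have along: "((\<lambda>s. F (x + s *\<^sub>R v)) has_real_derivative v \<bullet> G x) (at 0)" for v
  proof -
    have "((\<lambda>s. x + s *\<^sub>R v) has_derivative (\<lambda>s. s *\<^sub>R v)) (at 0)"
      by (auto intro!: derivative_eq_intros)
    moreover have "(F has_derivative (\<lambda>h. h \<bullet> G x)) (at (x + 0 *\<^sub>R v))"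
      using grad[of x] by simp
    ultimately have "((\<lambda>s. F (x + s *\<^sub>R v)) has_derivative (\<lambda>s. (s *\<^sub>R v) \<bullet> G x)) (at 0)"
      by (rule has_derivative_compose)
    then show ?thesis
      by (simp add: has_field_derivative_def mult_commute_abs)
  qed
  have "(T + \<epsilon> *\<^sub>R G x) \<bullet> G x > 0" "(T - \<epsilon> *\<^sub>R G x) \<bullet> G x < 0"
    using T \<open>G x \<noteq> 0\<close> \<open>\<epsilon> > 0\<close> by (simp_all add: inner_add_left inner_diff_left inner_commute[of T])
  from DERIV_pos_inc_right[OF along this(1)] DERIV_neg_dec_right[OF along this(2)]
  obtain d1 d2 where d: "d1 > 0" "d2 > 0"
    and pos: "\<And>s. 0 < s \<Longrightarrow> s < d1 \<Longrightarrow> F x < F (x + s *\<^sub>R (T + \<epsilon> *\<^sub>R G x))"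
    and neg: "\<And>s. 0 < s \<Longrightarrow> s < d2 \<Longrightarrow> F x > F (x + s *\<^sub>R (T - \<epsilon> *\<^sub>R G x))"
    by auto
  have cont: "continuous_on A F" for A
    by (rule has_derivative_continuous_on[OF has_derivative_at_withinI[OF grad]])
  show ?thesis
  proof (rule exI[of _ "min d1 d2"], intro conjI allI impI)
    show "min d1 d2 > 0"
      using d by simp
    fix s assume s: "0 < s \<and> s < min d1 d2"
    let ?f = "\<lambda>r. F (x + s *\<^sub>R T + r *\<^sub>R G x)"
    have "?f (- (\<epsilon> * s)) \<le> 0" "0 \<le> ?f (\<epsilon> * s)"
      using pos[of s] neg[of s] s \<open>F x = 0\<close>
      by (simp_all add: algebra_simps)
    moreover have "continuous_on {- (\<epsilon> * s)..\<epsilon> * s} ?f"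
      by (intro continuous_on_compose2[OF cont[of UNIV]] continuous_intros) auto
    moreover have "- (\<epsilon> * s) \<le> \<epsilon> * s"
      using s \<open>\<epsilon> > 0\<close> by simp
    ultimately obtain r where "- (\<epsilon> * s) \<le> r" "r \<le> \<epsilon> * s" "?f r = 0"
      using IVT'[of ?f] by blast
    then show "\<exists>r. \<bar>r\<bar> \<le> \<epsilon> * s \<and> x + s *\<^sub>R T + r *\<^sub>R G x \<in> S"
      unfolding S by (intro exI[of _ r]) auto
  qed
qed

text \<open>
  If \<open>T\<close> is orthogonal to \<open>G x\<close> then \<open>S\<close> has points close to \<open>x\<close> in nearly the direction \<open>T\<close>. The
  other equation \<open>F2\<close> vanishes at them too, so its derivative in the direction \<open>T\<close> is zero.
\<close>

lemma smooth_equations_parallel_gradients: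
  fixes x :: "'a::euclidean_space"
  assumes FG: "smooth_equation F G S" and FG2: "smooth_equation F2 G2 S" and x: "x \<in> S"
  obtains c where "c \<noteq> 0" "G2 x = c *\<^sub>R G x"
proof -
  have nz: "G x \<noteq> 0" "G2 x \<noteq> 0"
    using FG FG2 x by (auto simp: smooth_equation_def)
  have S2: "S = {y. F2 y = 0}" and der2: "(F2 has_derivative (\<lambda>h. h \<bullet> G2 x)) (at x)"
    using FG2 by (auto simp: smooth_equation_def gderiv_def)
  have orth: "G2 x \<bullet> T = 0" if T: "G x \<bullet> T = 0" for T
  proof -
    define K where "K = norm T + norm (G x) + \<bar>G2 x \<bullet> G x\<bar>"
    have bound: "\<bar>G2 x \<bullet> T\<bar> \<le> \<epsilon> * K" if "0 < \<epsilon>" "\<epsilon> \<le> 1" for \<epsilon>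
    proof -
      obtain d where "d > 0" and d: "\<And>s. 0 < s \<Longrightarrow> s < d \<Longrightarrow>
          \<exists>r. \<bar>r\<bar> \<le> \<epsilon> * s \<and> x + s *\<^sub>R T + r *\<^sub>R G x \<in> S"
        using level_set_points_in_tangent_direction[OF FG x T \<open>0 < \<epsilon>\<close>] by blast
      obtain \<delta> where "\<delta> > 0" and \<delta>: "\<And>y. norm (y - x) < \<delta> \<Longrightarrow>
          norm (F2 y - F2 x - (y - x) \<bullet> G2 x) \<le> \<epsilon> * norm (y - x)"
        using der2 \<open>0 < \<epsilon>\<close> unfolding has_derivative_at_alt by blast
      define L where "L = norm T + norm (G x)"
      have "L > 0"
        using nz by (simp add: L_def add_nonneg_pos)
      define s where "s = min (d / 2) (\<delta> / (2 * L))"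
      have "s > 0" "s < d"
        using \<open>d > 0\<close> \<open>\<delta> > 0\<close> \<open>L > 0\<close> by (auto simp: s_def)
      have "s * L \<le> \<delta> / (2 * L) * L"
        using \<open>L > 0\<close> by (intro mult_right_mono) (auto simp: s_def)
      then have "s * L < \<delta>"
        using \<open>L > 0\<close> \<open>\<delta> > 0\<close> by simp
      obtain r where r: "\<bar>r\<bar> \<le> \<epsilon> * s" and yS: "x + s *\<^sub>R T + r *\<^sub>R G x \<in> S"
        using d[OF \<open>s > 0\<close> \<open>s < d\<close>] by blast
      let ?h = "s *\<^sub>R T + r *\<^sub>R G x"
      have "\<bar>r\<bar> \<le> s"
        using r \<open>\<epsilon> \<le> 1\<close> \<open>s > 0\<close> mult_right_mono[of \<epsilon> 1 s] by linarith
      have "norm ?h \<le> s * norm T + \<bar>r\<bar> * norm (G x)"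
        using norm_triangle_ineq[of "s *\<^sub>R T" "r *\<^sub>R G x"] \<open>s > 0\<close> by simp
      also have "\<dots> \<le> s * L"
        using \<open>\<bar>r\<bar> \<le> s\<close> by (simp add: L_def algebra_simps mult_right_mono)
      finally have h: "norm ?h \<le> s * L" .
      have "\<bar>?h \<bullet> G2 x\<bar> \<le> \<epsilon> * norm ?h"
        using \<delta>[of "x + ?h"] h \<open>s * L < \<delta>\<close> yS x by (simp add: S2 add.assoc)
      also have "\<dots> \<le> \<epsilon> * (s * L)"
        using h \<open>0 < \<epsilon>\<close> by simp
      finally have 1: "\<bar>?h \<bullet> G2 x\<bar> \<le> \<epsilon> * (s * L)" .
      have "s * \<bar>G2 x \<bullet> T\<bar> = \<bar>?h \<bullet> G2 x - r * (G x \<bullet> G2 x)\<bar>"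
        using \<open>s > 0\<close> by (simp add: inner_add_left abs_mult inner_commute[of T])
      also have "\<dots> \<le> \<epsilon> * (s * L) + \<bar>r\<bar> * \<bar>G2 x \<bullet> G x\<bar>"
        using 1 abs_triangle_ineq4[of "?h \<bullet> G2 x" "r * (G x \<bullet> G2 x)"]
        by (simp add: abs_mult inner_commute)
      also have "\<dots> \<le> \<epsilon> * (s * L) + (\<epsilon> * s) * \<bar>G2 x \<bullet> G x\<bar>"
        using r by (simp add: mult_right_mono)
      also have "\<dots> = s * (\<epsilon> * K)"
        by (simp add: K_def L_def algebra_simps)
      finally show ?thesis
        using \<open>s > 0\<close> by simp
    qed
    have "\<bar>G2 x \<bullet> T\<bar> \<le> 0"
    proof (rule tendsto_le[OF trivial_limit_at_right_real])
      show "((\<lambda>\<epsilon>. \<epsilon> * K) \<longlongrightarrow> 0) (at_right 0)"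
        by (auto intro!: tendsto_eq_intros)
      show "((\<lambda>\<epsilon>::real. \<bar>G2 x \<bullet> T\<bar>) \<longlongrightarrow> \<bar>G2 x \<bullet> T\<bar>) (at_right 0)"
        by simp
      show "\<forall>\<^sub>F \<epsilon> in at_right 0. \<bar>G2 x \<bullet> T\<bar> \<le> \<epsilon> * K"
        unfolding eventually_at_right_field using bound by (intro exI[of _ 1]) simp
    qed
    then show ?thesis
      by simp
  qed
  define c where "c = (G x \<bullet> G2 x) / (G x \<bullet> G x)"
  define T where "T = G2 x - c *\<^sub>R G x"
  have "G x \<bullet> T = 0"
    using nz by (simp add: T_def c_def inner_diff_right)
  then have "T \<bullet> T = 0"
    using orth[of T] by (simp add: T_def inner_diff_left inner_diff_right inner_commute)
  then have "G2 x = c *\<^sub>R G x"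
    by (simp add: T_def)
  moreover from this have "c \<noteq> 0"
    using nz by auto
  ultimately show thesis
    using that by blast
qed

lemma tangent_hyperplane_eq:
  assumes "smooth_equation F G S" and "x \<in> S"
  shows "tangent_hyperplane S x = {y. G x \<bullet> (y - x) = 0}"
proof -
  have "G x \<bullet> (y - x) = 0" if FG2: "smooth_equation F2 G2 S" and "G2 x \<bullet> (y - x) = 0" for F2 G2 y
  proof -
    obtain c where "c \<noteq> 0" "G2 x = c *\<^sub>R G x"
      using smooth_equations_parallel_gradients[OF assms(1) FG2 assms(2)] .
    with that(2) show ?thesis
      by simp
  qed
  then show ?thesis
    using assms(1) by (auto simp: tangent_hyperplane_def)
qed

lemma unit_normal_parallel:
  assumes "smooth_equation F G S" and "x \<in> S" and "unit_normal S x N"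
  obtains c where "N = c *\<^sub>R G x"
proof -
  have "G x \<noteq> 0"
    using assms by (auto simp: smooth_equation_def)
  define c where "c = (G x \<bullet> N) / (G x \<bullet> G x)"
  define T where "T = N - c *\<^sub>R G x"
  have "G x \<bullet> T = 0"
    using \<open>G x \<noteq> 0\<close> by (simp add: T_def c_def inner_diff_right)
  then have "x + T \<in> tangent_hyperplane S x"
    by (simp add: tangent_hyperplane_eq[OF assms(1,2)])
  then have "N \<bullet> T = 0"
    using assms(3) by (force simp: unit_normal_def)
  then have "T \<bullet> T = 0"
    using \<open>G x \<bullet> T = 0\<close> by (simp add: T_def inner_diff_left)
  then have "N = c *\<^sub>R G x"
    by (simp add: T_def)
  then show thesis
    by (rule that)
qed

lemma curve_in_level_set_orthogonal:
  assumes FG: "smooth_equation F G S" and "t \<in> I" and "at t within I \<noteq> bot"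
    and c: "(c has_vector_derivative c') (at t within I)" and "\<And>s. s \<in> I \<Longrightarrow> c s \<in> S"
  shows "G (c t) \<bullet> c' = 0"
proof -
  have "(F has_derivative (\<lambda>h. h \<bullet> G (c t))) (at (c t) within c ` I)"
    using FG by (auto simp: smooth_equation_def gderiv_def intro: has_derivative_at_withinI)
  then have "((F \<circ> c) has_derivative ((\<lambda>h. h \<bullet> G (c t)) \<circ> (\<lambda>s. s *\<^sub>R c'))) (at t within I)"
    using c unfolding has_vector_derivative_def by (intro diff_chain_within)
  then have 1: "((F \<circ> c) has_vector_derivative c' \<bullet> G (c t)) (at t within I)"
    by (simp add: has_vector_derivative_def o_def)
  have "((\<lambda>s. 0) has_vector_derivative 0) (at t within I)"
    by simp
  then have "((F \<circ> c) has_vector_derivative 0) (at t within I)"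
    by (rule has_vector_derivative_transform[OF \<open>t \<in> I\<close>, rotated])
      (use assms in \<open>auto simp: smooth_equation_def\<close>)
  with 1 have "c' \<bullet> G (c t) = 0"
    using vector_derivative_unique_within[OF assms(3)] by blast
  then show ?thesis
    by (simp add: inner_commute)
qed

section \<open>The surface map in terms of the polar dual\<close>

text \<open>
  Pole of the hyperplane \<open>{y. G x \<bullet> (y - x) = 0}\<close> with respect to the unit sphere around the north
  pole \<open>e\<close>: this hyperplane is \<open>{y. polar_point G x \<bullet> (y - e) = 1}\<close>.
\<close>

definition polar_point ::
    "((real^'n) \<times> real \<Rightarrow> (real^'n) \<times> real) \<Rightarrow> (real^'n) \<times> real \<Rightarrow> (real^'n) \<times> real" where
  "polar_point G x = G x /\<^sub>R (G x \<bullet> (x - north_pole))"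

text \<open>
  The diffeomorphism from the set of poles of the hyperplanes that meet the open unit ball onto the
  open upper half space.
\<close>

definition lift_polar :: "(real^'n) \<times> real \<Rightarrow> (real^'n) \<times> real" where
  "lift_polar W = (fst W, sqrt ((norm (fst W))\<^sup>2 - 1 - 2 * snd W))"

lemma nonsingular_iff:
  assumes "smooth_equation F G S" and "x \<in> S"
  shows "x \<notin> singularity_set S \<longleftrightarrow> G x \<bullet> (x - north_pole) \<noteq> 0"
proof -
  have "G x \<bullet> (north_pole - x) = - (G x \<bullet> (x - north_pole))"
    by (simp add: inner_diff_right)
  then show ?thesis
    using assms by (auto simp: singularity_set_def tangent_hyperplane_eq[OF assms])
qed

lemma tangent_normal_correct:
  assumes "smooth_equation F G S" and "x \<in> S"
  shows "unit_normal S x (tangent_normal S x)"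
    and "tangent_distance S x *\<^sub>R tangent_normal S x \<in> tangent_hyperplane S x"
proof -
  have nz: "G x \<noteq> 0"
    using assms by (auto simp: smooth_equation_def)
  note H = tangent_hyperplane_eq[OF assms]
  define h where "h = (G x \<bullet> x) / norm (G x)"
  have foot: "(h / norm (G x)) *\<^sub>R G x \<in> tangent_hyperplane S x"
    using nz by (simp add: H h_def inner_diff_right dot_square_norm power2_eq_square)
  have "\<bar>h\<bar> \<le> dist 0 y" if "y \<in> tangent_hyperplane S x" for y
  proof -
    have "\<bar>G x \<bullet> x\<bar> = \<bar>G x \<bullet> y\<bar>"
      using that by (simp add: H inner_diff_right)
    also have "\<dots> \<le> norm (G x) * norm y"
      by (rule Cauchy_Schwarz_ineq2)
    finally show ?thesis
      using nz by (simp add: h_def field_simps)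
  qed
  then have "\<bar>h\<bar> \<le> tangent_distance S x"
    unfolding tangent_distance_def using foot by (subst infdist_notempty) (auto intro!: cINF_greatest)
  moreover have "tangent_distance S x \<le> \<bar>h\<bar>"
    using infdist_le[OF foot, of 0] nz by (simp add: tangent_distance_def)
  ultimately have dist: "tangent_distance S x = \<bar>h\<bar>"
    by simp
  \<comment> \<open>the unit normal pointing from the origin to the foot of the perpendicular; any sign if they coincide\<close>
  define \<psi> where "\<psi> = ((if h < 0 then - 1 else 1) / norm (G x)) *\<^sub>R G x"
  have "norm \<psi> = 1"
    using nz by (simp add: \<psi>_def)
  then have "unit_normal S x \<psi>"
    by (auto simp: unit_normal_def H \<psi>_def)
  moreover have "tangent_distance S x *\<^sub>R \<psi> = (h / norm (G x)) *\<^sub>R G x"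
    by (simp add: dist \<psi>_def)
  ultimately have "unit_normal S x \<psi> \<and> tangent_distance S x *\<^sub>R \<psi> \<in> tangent_hyperplane S x"
    using foot by simp
  then have "unit_normal S x (tangent_normal S x) \<and>
      tangent_distance S x *\<^sub>R tangent_normal S x \<in> tangent_hyperplane S x"
    unfolding tangent_normal_def by (rule someI)
  then show "unit_normal S x (tangent_normal S x)"
    and "tangent_distance S x *\<^sub>R tangent_normal S x \<in> tangent_hyperplane S x"
    by auto
qed

text \<open>
  With \<open>\<rho> = \<psi> \<bullet> x\<close> the denominator \<open>\<rho> - \<psi>\<^sub>n\<^sub>+\<^sub>1\<close> is \<open>\<psi> \<bullet> (x - e)\<close>, and \<open>W = \<psi> / (\<rho> - \<psi>\<^sub>n\<^sub>+\<^sub>1)\<close>. Hence the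
  last coordinate is the square root of \<open>\<bar>W\<bar>\<^sup>2 - (W \<bullet> x)\<^sup>2\<close>, where \<open>W \<bullet> x = 1 + W\<^sub>n\<^sub>+\<^sub>1\<close>.
\<close>

lemma surface_map_eq:
  assumes FG: "smooth_equation F G S" and x: "x \<in> S" and ns: "x \<notin> singularity_set S"
  shows "surface_map S x = lift_polar (polar_point G x)"
proof -
  define \<psi> where "\<psi> = tangent_normal S x"
  define \<rho> where "\<rho> = tangent_distance S x"
  define W where "W = polar_point G x"
  have un: "unit_normal S x \<psi>" and foot: "\<rho> *\<^sub>R \<psi> \<in> tangent_hyperplane S x"
    using tangent_normal_correct[OF FG x] by (auto simp: \<psi>_def \<rho>_def)
  obtain c where c: "\<psi> = c *\<^sub>R G x"
    using unit_normal_parallel[OF FG x un] .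
  have norm: "norm \<psi> = 1"
    using un by (simp add: unit_normal_def)
  then have "c \<noteq> 0"
    by (auto simp: c)
  have "\<psi> \<bullet> (\<rho> *\<^sub>R \<psi> - x) = 0"
    using un foot by (simp add: unit_normal_def)
  then have \<rho>: "\<rho> = \<psi> \<bullet> x"
    using norm by (simp add: inner_diff_right dot_square_norm)
  define d where "d = \<psi> \<bullet> (x - north_pole)"
  have d: "\<rho> - snd \<psi> = d"
    by (simp add: d_def \<rho> inner_diff_right north_pole_def inner_prod_def right_diff_distrib)
  have "G x \<bullet> (x - north_pole) \<noteq> 0"
    using nonsingular_iff[OF FG x] ns by simp
  then have "d \<noteq> 0" and W: "W = \<psi> /\<^sub>R d"
    using \<open>c \<noteq> 0\<close> by (simp_all add: d_def c W_def polar_point_def)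
  have "1 - \<rho>\<^sup>2 = (norm \<psi>)\<^sup>2 - \<rho>\<^sup>2"
    using norm by simp
  also have "\<dots> = (norm (fst \<psi>))\<^sup>2 + (snd \<psi>)\<^sup>2 - (d + snd \<psi>)\<^sup>2"
    using d by (simp add: norm_prod_def algebra_simps)
  also have "\<dots> = d\<^sup>2 * ((norm (fst W))\<^sup>2 - 1 - 2 * snd W)"
    using \<open>d \<noteq> 0\<close> by (simp add: W power2_eq_square field_simps)
  finally have "sqrt (1 - \<rho>\<^sup>2) / \<bar>d\<bar> = sqrt ((norm (fst W))\<^sup>2 - 1 - 2 * snd W)"
    using \<open>d \<noteq> 0\<close> by (simp add: real_sqrt_mult)
  then show ?thesis
    using d W by (simp add: surface_map_def sphere_coords_def lift_polar_def
        flip: \<psi>_def \<rho>_def W_def)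
qed

section \<open>Axial symmetry\<close>

lemma rotation_matrix_maps_to:
  fixes u v :: "real^'n"
  assumes "2 \<le> CARD('n)" and "norm u = norm v"
  obtains A where "rotation_matrix A" "A *v u = v"
proof -
  obtain f where f: "orthogonal_transformation f" "det (matrix f) = 1" "f u = v"
    using rotation_exists[OF assms] by metis
  then have "rotation_matrix (matrix f)"
    by (simp add: rotation_matrix_def orthogonal_transformation_matrix)
  moreover have "matrix f *v u = v"
    using f by (simp add: matrix_works orthogonal_transformation_linear)
  ultimately show thesis
    using that by blast
qed

lemma inner_axial_map_transpose:
  "axial_map (transpose A) u \<bullet> v = u \<bullet> axial_map A v"
  by (simp add: axial_map_def inner_prod_def dot_lmul_matrix)

lemma axial_map_diff: "axial_map A (x - y) = axial_map A x - axial_map A y"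
  by (simp add: axial_map_def matrix_vector_mult_diff_distrib)

lemma axial_map_scaleR: "axial_map A (c *\<^sub>R x) = c *\<^sub>R axial_map A x"
  by (simp add: axial_map_def matrix_vector_mult_scaleR)

lemma axial_map_zero: "axial_map A 0 = 0"
  using axial_map_scaleR[of A 0 0] by simp

lemma axial_map_north_pole: "axial_map A north_pole = north_pole"
  by (simp add: axial_map_def north_pole_def)

lemma bounded_linear_axial_map: "bounded_linear (axial_map A)"
proof -
  have "linear (axial_map A)"
    by (rule linearI)
      (simp_all add: axial_map_def matrix_vector_right_distrib matrix_vector_mult_scaleR)
  then show ?thesis
    by (simp add: linear_conv_bounded_linear)
qed

lemma axial_map_transpose_cancel:
  assumes "rotation_matrix A"
  shows "axial_map A (axial_map (transpose A) x) = x"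
  using assms
  by (simp add: axial_map_def rotation_matrix_def orthogonal_matrix_def matrix_vector_mul_assoc
      del: transpose_matrix_vector)

lemma inj_axial_map:
  assumes "rotation_matrix A"
  shows "inj (axial_map A)"
  by (rule inj_on_inverseI[of _ "axial_map (transpose A)"])
    (use assms in \<open>simp add: axial_map_def rotation_matrix_def orthogonal_matrix_def
      matrix_vector_mul_assoc del: transpose_matrix_vector\<close>)

lemma smooth_equation_axial_map:
  assumes FG: "smooth_equation F G S" and sym: "axially_symmetric S" and A: "rotation_matrix A"
  shows "smooth_equation (F \<circ> axial_map A) (\<lambda>x. axial_map (transpose A) (G (axial_map A x))) S"
proof -
  have S: "S = {x. F x = 0}" and cont: "continuous_on UNIV G" and nz: "\<And>x. x \<in> S \<Longrightarrow> G x \<noteq> 0"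
    and der: "\<And>x. (F has_derivative (\<lambda>h. h \<bullet> G x)) (at x)"
    using FG by (auto simp: smooth_equation_def gderiv_def)
  have im: "axial_map A ` S = S"
    using sym A by (simp add: axially_symmetric_def)
  have mem: "axial_map A x \<in> S \<longleftrightarrow> x \<in> S" for x
    using im inj_image_mem_iff[OF inj_axial_map[OF A]] by metis
  note lin = bounded_linear_axial_map
  show ?thesis
    unfolding smooth_equation_def
  proof (intro conjI allI ballI)
    fix x
    have "(axial_map A has_derivative axial_map A) (at x)"
      by (rule bounded_linear_imp_has_derivative[OF lin])
    then have "((\<lambda>x. F (axial_map A x)) has_derivative (\<lambda>h. axial_map A h \<bullet> G (axial_map A x))) (at x)"
      by (rule has_derivative_compose[OF _ der])
    then show "GDERIV (F \<circ> axial_map A) x :> axial_map (transpose A) (G (axial_map A x))"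
      by (simp add: gderiv_def o_def inner_commute[of _ "axial_map (transpose A) _"]
          inner_axial_map_transpose) (simp add: inner_commute)
  next
    have "continuous_on UNIV (\<lambda>x. G (axial_map A x))"
      by (rule continuous_on_compose2[OF cont linear_continuous_on[OF lin]]) simp
    then show "continuous_on UNIV (\<lambda>x. axial_map (transpose A) (G (axial_map A x)))"
      by (rule continuous_on_compose2[OF linear_continuous_on[OF lin, of UNIV]]) simp
  next
    show "S = {x. (F \<circ> axial_map A) x = 0}"
      using mem by (auto simp: S)
  next
    fix x assume "x \<in> S"
    then have "G (axial_map A x) \<noteq> 0"
      using mem nz by blast
    then show "axial_map (transpose A) (G (axial_map A x)) \<noteq> 0"
      using axial_map_transpose_cancel[OF A, of "G (axial_map A x)"] axial_map_zero[of A] by force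
  qed
qed

text \<open>
  The pole depends only on the tangent hyperplane, and rotating the equation by \<open>A\<close> gives another
  equation of the same hypersurface.
\<close>

lemma polar_point_axial_map:
  assumes FG: "smooth_equation F G S" and sym: "axially_symmetric S" and A: "rotation_matrix A"
    and x: "x \<in> S"
  shows "polar_point G (axial_map A x) = axial_map A (polar_point G x)"
proof -
  let ?y = "axial_map A x"
  obtain c where "c \<noteq> 0" and c: "axial_map (transpose A) (G ?y) = c *\<^sub>R G x"
    using smooth_equations_parallel_gradients[OF FG smooth_equation_axial_map[OF FG sym A] x] by blast
  have G: "G ?y = c *\<^sub>R axial_map A (G x)"
    using arg_cong[OF c, of "axial_map A"] by (simp add: axial_map_transpose_cancel[OF A] axial_map_scaleR)
  have "G ?y \<bullet> (?y - north_pole) = G ?y \<bullet> axial_map A (x - north_pole)"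
    by (simp add: axial_map_diff axial_map_north_pole)
  also have "\<dots> = c * (G x \<bullet> (x - north_pole))"
    by (simp add: c flip: inner_axial_map_transpose)
  finally show ?thesis
    using \<open>c \<noteq> 0\<close> by (simp add: polar_point_def G axial_map_scaleR)
qed

section \<open>Space like graphs\<close>

lemma space_like_graph:
  fixes H :: "real^'n \<Rightarrow> real"
  assumes H: "\<And>v. GDERIV H v :> g v" and g: "continuous_on UNIV g" and g1: "\<And>v. norm (g v) \<le> 1"
  shows "space_like {(v, y). y = H v}"
proof -
  let ?S = "{(v, y). y = H v}"
  let ?F = "\<lambda>x::(real^'n) \<times> real. snd x - H (fst x)"
  let ?G = "\<lambda>x::(real^'n) \<times> real. (- g (fst x), 1::real)"
  have derH: "(H has_derivative (\<lambda>h. h \<bullet> g v)) (at v)" for v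
    using H by (simp add: gderiv_def)
  have "(?F has_derivative (\<lambda>h. snd h - fst h \<bullet> g (fst x))) (at x)" for x
    by (intro has_derivative_diff has_derivative_snd has_derivative_ident
        has_derivative_compose[OF has_derivative_fst[OF has_derivative_ident] derH])
  then have "GDERIV ?F x :> ?G x" for x
    by (simp add: gderiv_def inner_prod_def algebra_simps)
  moreover have "continuous_on UNIV ?G"
    by (intro continuous_intros continuous_on_compose2[OF g]) auto
  ultimately have FG: "smooth_equation ?F ?G ?S"
    by (auto simp: smooth_equation_def zero_prod_def)
  have "(0, H 0) \<in> ?S"
    by simp
  then have "smooth_hypersurface ?S"
    using FG unfolding smooth_hypersurface_def by blast
  moreover have "connected ?S"
  proof -
    have "continuous_on UNIV H"
      by (rule has_derivative_continuous_on[OF has_derivative_at_withinI[OF derH]])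
    then have "connected (range (\<lambda>v. (v, H v)))"
      by (intro connected_continuous_image continuous_intros) auto
    moreover have "range (\<lambda>v. (v, H v)) = ?S"
      by auto
    ultimately show ?thesis
      by simp
  qed
  moreover have "(\<Sum>i\<in>UNIV. (fst N $ i)\<^sup>2) \<le> (snd N)\<^sup>2"
    if x: "x \<in> ?S" and N: "unit_normal ?S x N" for x N
  proof -
    obtain c where "N = c *\<^sub>R ?G x"
      using unit_normal_parallel[OF FG x N] .
    then have fst: "fst N = - c *\<^sub>R g (fst x)" and snd: "snd N = c"
      by simp_all
    have "(\<Sum>i\<in>UNIV. (fst N $ i)\<^sup>2) = (norm (fst N))\<^sup>2"
      by (simp add: norm_vec_def L2_set_def sum_nonneg)
    also have "\<dots> = c\<^sup>2 * (norm (g (fst x)))\<^sup>2"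
      by (simp add: fst power_mult_distrib)
    also have "\<dots> \<le> c\<^sup>2 * 1"
      using g1[of "fst x"] by (intro mult_left_mono) (auto simp: power_le_one)
    finally show ?thesis
      by (simp add: snd)
  qed
  ultimately show ?thesis
    by (simp add: space_like_def)
qed

text \<open>An even function has derivative zero at \<open>0\<close>, which removes the singularity of the norm.\<close>

lemma gderiv_even_function_of_norm:
  fixes f :: "real \<Rightarrow> real" and v :: "'a::euclidean_space"
  assumes f: "\<And>s. (f has_real_derivative f' s) (at s)" and even: "\<And>s. f (- s) = f s"
  shows "f' 0 = 0" and "GDERIV (\<lambda>v. f (norm v)) v :> (f' (norm v) / norm v) *\<^sub>R v"
proof -
  have "((\<lambda>s. f (- s)) has_real_derivative - f' 0) (at 0)"
    using DERIV_mirror[of f "f' 0" 0] f[of 0] by simp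
  moreover have "(\<lambda>s. f (- s)) = f"
    using even by auto
  ultimately have "(f has_real_derivative - f' 0) (at 0)"
    by (simp only:)
  then have "f' 0 = - f' 0"
    by (rule DERIV_unique[OF f[of 0]])
  then show f'0: "f' 0 = 0"
    by linarith
  show "GDERIV (\<lambda>v. f (norm v)) v :> (f' (norm v) / norm v) *\<^sub>R v"
  proof (cases "v = 0")
    case False
    have "GDERIV (\<lambda>v. f (norm v)) v :> f' (norm v) *\<^sub>R sgn v"
      by (rule GDERIV_DERIV_compose[OF GDERIV_norm[OF False] f])
    then show ?thesis
      by (simp add: sgn_div_norm divide_inverse)
  next
    case True
    have "((\<lambda>v::'a. f (norm v)) has_derivative (\<lambda>h. 0)) (at 0)"
      unfolding has_derivative_at_alt
    proof (intro conjI allI impI)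
      fix e :: real assume "e > 0"
      have "(f has_derivative (\<lambda>h. 0)) (at 0)"
        using f[of 0] by (simp add: has_field_derivative_def f'0 lambda_zero)
      then obtain d where "d > 0" and d: "\<And>y. norm (y - 0) < d \<Longrightarrow>
          norm (f y - f 0 - 0) \<le> e * norm (y - 0)"
        using \<open>e > 0\<close> unfolding has_derivative_at_alt by blast
      have "norm (f (norm y) - f (norm (0::'a)) - 0) \<le> e * norm (y - 0)"
        if "norm (y - 0) < d" for y :: 'a
        using d[of "norm y"] that by simp
      with \<open>d > 0\<close> show "\<exists>d>0. \<forall>y::'a. norm (y - 0) < d \<longrightarrow>
          norm (f (norm y) - f (norm (0::'a)) - 0) \<le> e * norm (y - 0)"
        by blast
    qed simp
    then show ?thesis
      using True by (simp add: gderiv_def)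
  qed
qed

lemma continuous_radial_field:
  fixes f' :: "real \<Rightarrow> real"
  assumes f': "continuous_on UNIV f'" and "f' 0 = 0"
  shows "continuous_on UNIV (\<lambda>v::'a::real_normed_vector. (f' (norm v) / norm v) *\<^sub>R v)"
proof -
  let ?g = "\<lambda>v::'a. (f' (norm v) / norm v) *\<^sub>R v"
  have c: "isCont (\<lambda>v::'a. f' (norm v)) v" for v
    using f' by (intro isCont_o2[OF isCont_norm[OF continuous_ident]])
      (simp add: continuous_on_eq_continuous_at)
  have "isCont ?g v" for v
  proof (cases "v = 0")
    case False
    then show ?thesis
      by (intro continuous_intros c) auto
  next
    case True
    have "(\<lambda>v::'a. \<bar>f' (norm v)\<bar>) \<midarrow>0\<rightarrow> 0"
      using c[of 0] \<open>f' 0 = 0\<close> by (intro tendsto_rabs_zero) (simp add: isCont_def)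
    then have "?g \<midarrow>0\<rightarrow> 0"
      by (rule Lim_null_comparison[rotated]) (auto intro!: always_eventually)
    then show ?thesis
      using True by (simp add: isCont_def)
  qed
  then show ?thesis
    by (simp add: continuous_on_eq_continuous_at)
qed

section \<open>The polar dual of a plane curve\<close>

text \<open>
  In coordinates with origin at the pole \<open>(0, 1)\<close> the tangent line at \<open>(a, b)\<close> is the polar of
  \<open>(b', -a') / D\<close> with \<open>D = a b' - (b - 1) a'\<close>. By duality the derivative of this point is orthogonal
  to \<open>(a, b - 1)\<close>, and its length is governed by the curvature.
\<close>

lemma polar_curve_derivatives:
  fixes a b a1 b1 :: "real \<Rightarrow> real"
  assumes "(a has_real_derivative a1 t) (at t within I)" "(a1 has_real_derivative a2) (at t within I)"
    and "(b has_real_derivative b1 t) (at t within I)" "(b1 has_real_derivative b2) (at t within I)"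
    and D: "D = (\<lambda>t. a t * b1 t - (b t - 1) * a1 t)" "D t \<noteq> 0"
  shows "((\<lambda>t. b1 t / D t) has_real_derivative
      (1 - b t) * (a1 t * b2 - a2 * b1 t) / (D t)\<^sup>2) (at t within I)"
    and "((\<lambda>t. - a1 t / D t) has_real_derivative
      a t * (a1 t * b2 - a2 * b1 t) / (D t)\<^sup>2) (at t within I)"
proof -
  have D': "(D has_real_derivative a t * b2 - (b t - 1) * a2) (at t within I)"
    unfolding D(1) using assms(1-4) by (auto intro!: derivative_eq_intros)
  show "((\<lambda>t. b1 t / D t) has_real_derivative
      (1 - b t) * (a1 t * b2 - a2 * b1 t) / (D t)\<^sup>2) (at t within I)"
    by (rule DERIV_cong[OF DERIV_divide[OF assms(4) D' D(2)]])
      (simp add: D(1) power2_eq_square algebra_simps)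
  show "((\<lambda>t. - a1 t / D t) has_real_derivative
      a t * (a1 t * b2 - a2 * b1 t) / (D t)\<^sup>2) (at t within I)"
    by (rule DERIV_cong[OF DERIV_divide[OF DERIV_minus[OF assms(2)] D' D(2)]])
      (simp add: D(1) power2_eq_square algebra_simps)
qed

text \<open>
  Here \<open>((1 - b) q - a) / ((1 - b) z)\<close> with \<open>z\<^sup>2 = q\<^sup>2 - 1 - 2 w\<close> is the slope of the image curve, so
  its modulus is less than one exactly because \<open>(a, b)\<close> lies inside the unit circle.
\<close>

lemma slope_identity:
  fixes a b q w :: real
  assumes "q * a + w * (b - 1) = 1"
  shows "(1 - b)\<^sup>2 * (q\<^sup>2 - 1 - 2 * w) = ((1 - b) * q - a)\<^sup>2 + (1 - a\<^sup>2 - b\<^sup>2)"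
proof -
  have w: "(1 - b) * w = q * a - 1"
    using assms by (simp add: algebra_simps)
  have "(1 - b)\<^sup>2 * (q\<^sup>2 - 1 - 2 * w) = (1 - b)\<^sup>2 * (q\<^sup>2 - 1) - 2 * (1 - b) * ((1 - b) * w)"
    by (simp add: power2_eq_square algebra_simps)
  also have "\<dots> = ((1 - b) * q - a)\<^sup>2 + (1 - a\<^sup>2 - b\<^sup>2)"
    unfolding w by (simp add: power2_eq_square algebra_simps)
  finally show ?thesis .
qed

lemma inj_on_interval_if_derivative_nonzero:
  fixes q :: "real \<Rightarrow> real"
  assumes I: "is_interval I"
    and q: "\<And>t. t \<in> I \<Longrightarrow> (q has_real_derivative q' t) (at t within I)"
    and nz: "\<And>t. t \<in> I \<Longrightarrow> q' t \<noteq> 0"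
  shows "inj_on q I"
proof (rule linorder_inj_onI')
  fix s t assume st: "s \<in> I" "t \<in> I" "s < t"
  then have sub: "{s..t} \<subseteq> I"
    using mem_is_interval_1_I[OF I st(1,2)] by auto
  have "(q has_derivative (\<lambda>h. q' x * h)) (at x within {s..t})" if "s \<le> x" "x \<le> t" for x
  proof (rule has_derivative_subset[OF _ sub])
    have "x \<in> I"
      using sub that by auto
    then show "(q has_derivative (\<lambda>h. q' x * h)) (at x within I)"
      using q[of x] by (simp add: has_field_derivative_def)
  qed
  then obtain x where "x \<in> {s<..<t}" "q t - q s = q' x * (t - s)"
    using mvt_simple[of s t q "\<lambda>x h. q' x * h"] \<open>s < t\<close> by blast
  moreover from this have "x \<in> I"
    using sub by (meson atLeastAtMost_iff greaterThanLessThan_iff less_imp_le subsetD)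
  ultimately have "q t - q s \<noteq> 0"
    using nz[of x] \<open>s < t\<close> by simp
  then show "q s \<noteq> q t"
    by simp
qed

lemma continuously_differentiable_reparametrization:
  fixes q z :: "real \<Rightarrow> real"
  assumes I: "open I" "is_interval I" and inj: "inj_on q I" and onto: "q ` I = UNIV"
    and q: "\<And>t. t \<in> I \<Longrightarrow> (q has_real_derivative q' t) (at t)"
    and nz: "\<And>t. t \<in> I \<Longrightarrow> q' t \<noteq> 0"
    and z: "\<And>t. t \<in> I \<Longrightarrow> (z has_real_derivative m t * q' t) (at t)"
    and m: "continuous_on I m"
  obtains f f' where "\<And>t. t \<in> I \<Longrightarrow> f (q t) = z t" "\<And>t. t \<in> I \<Longrightarrow> f' (q t) = m t"
    "\<And>s. (f has_real_derivative f' s) (at s)" "continuous_on UNIV f'"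
proof -
  have "continuous_on I q"
    using q by (meson DERIV_continuous_on has_field_derivative_at_within)
  then obtain g where "homeomorphism I UNIV q g"
    using homeomorphism_into_1d[of I q UNIV] inj onto I(2)
    by (auto simp: is_interval_path_connected)
  then have g: "continuous_on UNIV g" "\<And>s. g s \<in> I" "\<And>s. q (g s) = s" "\<And>t. t \<in> I \<Longrightarrow> g (q t) = t"
    by (auto simp: homeomorphism_def)
  have g': "(g has_real_derivative inverse (q' (g s))) (at s)" for s
    by (rule DERIV_inverse_function[where f=q and a="s - 1" and b="s + 1"])
      (use g q nz in \<open>auto simp: continuous_on_eq_continuous_at\<close>)
  show thesis
  proof (rule that[of "z \<circ> g" "m \<circ> g"])
    show "(z \<circ> g has_real_derivative (m \<circ> g) s) (at s)" for s
      using DERIV_chain[OF z[OF g(2)] g', of s] nz[OF g(2), of s] by (simp add: mult.assoc)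
    show "continuous_on UNIV (m \<circ> g)"
      using m g(1,2) by (intro continuous_on_compose) (auto elim: continuous_on_subset)
  qed (use g in auto)
qed

section \<open>The generating arc and its image\<close>

lemma norm_axis: "norm (axis k u :: real^'n) = \<bar>u\<bar>"
  by (simp add: norm_eq_sqrt_inner inner_axis_axis)

text \<open>
  Off the axis the orbit of the point under rotations contains, for every \<open>j \<noteq> k\<close>, a curve through it
  in the direction \<open>e\<^sub>j\<close>, and the gradient is orthogonal to it. On the axis the horizontal part of the
  pole is invariant under all rotations, one of which maps it to its negative, so it vanishes.
\<close>

lemma gradient_in_profile_plane:
  fixes k :: "'n::finite"
  assumes FG: "smooth_equation F G S" and sym: "axially_symmetric S"
    and x: "(axis k u, v) \<in> S" and ns: "(axis k u, v) \<notin> singularity_set S"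
  obtains g where "G (axis k u, v) = (axis k g, snd (G (axis k u, v)))"
proof -
  let ?x = "(axis k u, v) :: (real^'n) \<times> real"
  have "fst (G ?x) $ j = 0" if "j \<noteq> k" for j
  proof -
    have "card {j, k} \<le> CARD('n)"
      by (intro card_mono) auto
    then have n2: "2 \<le> CARD('n)"
      using \<open>j \<noteq> k\<close> by simp
    show ?thesis
    proof (cases "u = 0")
      case False
      define c :: "real \<Rightarrow> (real^'n) \<times> real"
        where "c \<theta> = (cos \<theta> *\<^sub>R axis k u + sin \<theta> *\<^sub>R axis j u, v)" for \<theta>
      have "c \<theta> \<in> S" for \<theta>
      proof -
        have "(norm (cos \<theta> *\<^sub>R axis k u + sin \<theta> *\<^sub>R axis j u))\<^sup>2 = (cos \<theta>)\<^sup>2 * u\<^sup>2 + (sin \<theta>)\<^sup>2 * u\<^sup>2"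
          unfolding power2_norm_eq_inner using \<open>j \<noteq> k\<close>
          by (simp add: inner_add_left inner_add_right inner_axis_axis power2_eq_square)
        also have "\<dots> = (norm (axis k u))\<^sup>2"
          by (simp add: norm_axis flip: distrib_right)
        finally have "norm (axis k u) = norm (cos \<theta> *\<^sub>R axis k u + sin \<theta> *\<^sub>R axis j u)"
          by simp
        from rotation_matrix_maps_to[OF n2 this]
        obtain A where A: "rotation_matrix A"
          "A *v axis k u = cos \<theta> *\<^sub>R axis k u + sin \<theta> *\<^sub>R axis j u" .
        then have "c \<theta> = axial_map A ?x"
          by (simp add: c_def axial_map_def)
        then show ?thesis
          using x sym A(1) unfolding axially_symmetric_def by blast
      qed
      moreover have "(c has_vector_derivative (axis j u, 0)) (at 0)"
        unfolding c_def has_vector_derivative_def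
        by (auto intro!: derivative_eq_intros)
      ultimately have "G (c 0) \<bullet> (axis j u, 0) = 0"
        using curve_in_level_set_orthogonal[OF FG, of 0 UNIV c] by simp
      then show ?thesis
        using False by (simp add: c_def inner_prod_def inner_axis)
    next
      case True
      define W where "W = polar_point G ?x"
      obtain A where A: "rotation_matrix A" "A *v fst W = - fst W"
        using rotation_matrix_maps_to[OF n2, of "fst W" "- fst W"] by auto
      have "axial_map A ?x = ?x"
        using True by (simp add: axial_map_def axis_eq_0_iff[THEN iffD2])
      then have "axial_map A W = W"
        using polar_point_axial_map[OF FG sym A(1) x] by (simp add: W_def)
      then have "fst W = - fst W"
        using A(2) by (metis axial_map_def fst_conv)
      then have "fst W $ j = - (fst W $ j)"
        by (metis vector_uminus_component)
      then have "fst W $ j = 0"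
        by linarith
      then show ?thesis
        using nonsingular_iff[OF FG x] ns by (simp add: W_def polar_point_def)
    qed
  qed
  then have "fst (G ?x) = axis k (fst (G ?x) $ k)"
    by (simp add: vec_eq_iff axis_def)
  then show thesis
    using that[of "fst (G ?x) $ k"] by (metis prod.collapse)
qed

text \<open>
  The section of \<open>V\<close> by the plane of \<open>e\<^sub>k\<close> and \<open>e\<^sub>n\<^sub>+\<^sub>1\<close> is traced by \<open>(a, b)\<close>, with derivatives
  \<open>(a1, b1)\<close> and \<open>(a2, b2)\<close>. At end points of \<open>I\<close> they are one-sided, until \<open>I\<close> is seen to be open.
\<close>

locale generating_arc =
  fixes F G and S V :: "((real^'n) \<times> real) set" and k :: 'n
    and I :: "real set" and a a1 a2 b b1 b2 :: "real \<Rightarrow> real"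
  assumes FG: "smooth_equation F G S"
    and compact: "compact S" and ball: "S \<subseteq> ball 0 1" and sym: "axially_symmetric S"
    and sym_V: "axially_symmetric V"
    and component: "V \<in> components (S - singularity_set S)"
    and open_V: "openin (top_of_set S) V"
    and interval: "is_interval I" "interior I \<noteq> {}"
    and arc: "\<And>u v. (axis k u, v) \<in> V \<longleftrightarrow> (\<exists>t\<in>I. u = a t \<and> v = b t)"
    and der_a: "\<And>t. t \<in> I \<Longrightarrow> (a has_real_derivative a1 t) (at t within I)"
      "\<And>t. t \<in> I \<Longrightarrow> (a1 has_real_derivative a2 t) (at t within I)"
    and der_b: "\<And>t. t \<in> I \<Longrightarrow> (b has_real_derivative b1 t) (at t within I)"
      "\<And>t. t \<in> I \<Longrightarrow> (b1 has_real_derivative b2 t) (at t within I)"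
    and curvature: "\<And>t. t \<in> I \<Longrightarrow> a1 t * b2 t - a2 t * b1 t \<noteq> 0"
begin

definition X :: "real \<Rightarrow> (real^'n) \<times> real" where "X t = (axis k (a t), b t)"

text \<open>
  \<open>(q t, w t)\<close> is the pole of the tangent line at \<open>(a t, b t)\<close>, and \<open>(q t, z t)\<close> is the image of this
  point in the target plane of the surface map.
\<close>

definition D :: "real \<Rightarrow> real" where "D = (\<lambda>t. a t * b1 t - (b t - 1) * a1 t)"

definition q :: "real \<Rightarrow> real" where "q = (\<lambda>t. b1 t / D t)"

definition w :: "real \<Rightarrow> real" where "w = (\<lambda>t. - a1 t / D t)"

definition z :: "real \<Rightarrow> real" where "z t = sqrt ((q t)\<^sup>2 - 1 - 2 * w t)"

definition slope :: "real \<Rightarrow> real" where "slope t = ((1 - b t) * q t - a t) / ((1 - b t) * z t)"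

lemma X_in_V: "t \<in> I \<Longrightarrow> X t \<in> V"
  using arc[of "a t" "b t"] by (auto simp: X_def)

lemma V_subset: "V \<subseteq> S" "x \<in> V \<Longrightarrow> x \<notin> singularity_set S"
  using in_components_subset[OF component] by auto

lemma inside_unit_circle: "t \<in> I \<Longrightarrow> (a t)\<^sup>2 + (b t)\<^sup>2 < 1"
proof -
  assume "t \<in> I"
  then have "X t \<in> ball 0 1"
    using X_in_V V_subset(1) ball by blast
  then have "norm (X t) < 1"
    by simp
  then show ?thesis
    by (simp add: X_def norm_prod_def norm_axis)
qed

lemma b_less_1: "t \<in> I \<Longrightarrow> b t < 1"
  using inside_unit_circle[of t] by (smt (verit) one_power2 power_mono zero_le_power2)

lemma at_within_I: "t \<in> I \<Longrightarrow> at t within I \<noteq> bot"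
proof -
  assume "t \<in> I"
  moreover have "I \<noteq> {t}"
    using interval(2) by auto
  ultimately show ?thesis
    using interval(1) connected_imp_perfect
    by (metis is_interval_connected is_singletonI' is_singleton_def singletonD trivial_limit_within)
qed

lemma velocity_nonzero: "t \<in> I \<Longrightarrow> (a1 t, b1 t) \<noteq> (0, 0)"
  using curvature[of t] by auto

lemma polar_point_X:
  assumes t: "t \<in> I"
  shows "D t \<noteq> 0" and "polar_point G (X t) = (axis k (q t), w t)"
    and "G (X t) \<bullet> (axis k (a1 t), b1 t) = 0"
proof -
  have xV: "X t \<in> V" and xS: "X t \<in> S" and ns: "X t \<notin> singularity_set S"
    using X_in_V[OF t] V_subset by auto
  obtain g h where G: "G (X t) = (axis k g, h)"
    using gradient_in_profile_plane[OF FG sym, of k "a t" "b t"] xS ns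
    unfolding X_def by metis
  have "(X has_vector_derivative (axis k (a1 t), b1 t)) (at t within I)"
  proof -
    have "bounded_linear (\<lambda>u. axis k u :: real^'n)"
      by (rule linear_conv_bounded_linear[THEN iffD1], rule linearI) (simp_all add: axis_def vec_eq_iff)
    then have "((\<lambda>t. axis k (a t) :: real^'n) has_vector_derivative axis k (a1 t)) (at t within I)"
      using bounded_linear.has_vector_derivative der_a(1)[OF t]
      by (metis has_real_derivative_iff_has_vector_derivative)
    moreover have "(b has_vector_derivative b1 t) (at t within I)"
      using der_b(1)[OF t] by (simp add: has_real_derivative_iff_has_vector_derivative)
    ultimately show ?thesis
      unfolding X_def[abs_def] by (rule has_vector_derivative_Pair)
  qed
  then show orth: "G (X t) \<bullet> (axis k (a1 t), b1 t) = 0"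
    using curve_in_level_set_orthogonal[OF FG t at_within_I[OF t]] X_in_V V_subset(1) by blast
  then have gh: "g * a1 t + h * b1 t = 0"
    by (simp add: G inner_prod_def inner_axis_axis)
  obtain c where c: "g = c * b1 t" "h = - c * a1 t"
  proof (cases "a1 t = 0")
    case True
    then have "b1 t \<noteq> 0"
      using velocity_nonzero[OF t] by auto
    then show thesis
      using that[of "g / b1 t"] gh True by auto
  next
    case False
    then show thesis
      using that[of "- h / a1 t"] gh by (auto simp: field_simps)
  qed
  have "G (X t) \<bullet> (X t - north_pole) = c * D t"
    unfolding G by (simp add: X_def north_pole_def inner_axis_axis D_def c algebra_simps)
  moreover from this have cD: "c * D t \<noteq> 0"
    using nonsingular_iff[OF FG xS] ns by simp
  ultimately show "D t \<noteq> 0" "polar_point G (X t) = (axis k (q t), w t)"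
    by (auto simp: polar_point_def G q_def w_def c axis_def vec_eq_iff divide_simps)
qed

lemma polarity: "t \<in> I \<Longrightarrow> q t * a t + w t * (b t - 1) = 1"
proof -
  assume "t \<in> I"
  have "q t * a t + w t * (b t - 1) = (a t * b1 t - (b t - 1) * a1 t) / D t"
    by (simp add: q_def w_def add_divide_distrib diff_divide_distrib algebra_simps)
  also have "\<dots> = D t / D t"
    by (simp add: D_def)
  finally show ?thesis
    using polar_point_X(1)[OF \<open>t \<in> I\<close>] by simp
qed

lemma derivative_q:
  assumes "t \<in> I"
  shows "(q has_real_derivative (1 - b t) * (a1 t * b2 t - a2 t * b1 t) / (D t)\<^sup>2) (at t within I)"
  unfolding q_def
  by (rule polar_curve_derivatives(1)[OF der_a[OF assms] der_b[OF assms] D_def polar_point_X(1)[OF assms]])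

lemma derivative_w:
  assumes "t \<in> I"
  shows "(w has_real_derivative a t * (a1 t * b2 t - a2 t * b1 t) / (D t)\<^sup>2) (at t within I)"
  unfolding w_def
  by (rule polar_curve_derivatives(2)[OF der_a[OF assms] der_b[OF assms] D_def polar_point_X(1)[OF assms]])

lemma derivative_q_nonzero:
  "t \<in> I \<Longrightarrow> (1 - b t) * (a1 t * b2 t - a2 t * b1 t) / (D t)\<^sup>2 \<noteq> 0"
  using b_less_1[of t] curvature[of t] polar_point_X(1)[of t] by simp

lemma inj_on_q: "inj_on q I"
  by (rule inj_on_interval_if_derivative_nonzero[OF interval(1) derivative_q derivative_q_nonzero])

lemma continuous_on_q: "continuous_on I q"
  using derivative_q by (rule DERIV_continuous_on)

lemma height_positive: "t \<in> I \<Longrightarrow> 0 < (q t)\<^sup>2 - 1 - 2 * w t"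
  and slope_less_1: "t \<in> I \<Longrightarrow> \<bar>slope t\<bar> < 1"
proof -
  assume t: "t \<in> I"
  let ?n = "(1 - b t) * q t - a t"
  have id: "(1 - b t)\<^sup>2 * ((q t)\<^sup>2 - 1 - 2 * w t) = ?n\<^sup>2 + (1 - (a t)\<^sup>2 - (b t)\<^sup>2)"
    by (rule slope_identity[OF polarity[OF t]])
  then have less: "?n\<^sup>2 < (1 - b t)\<^sup>2 * ((q t)\<^sup>2 - 1 - 2 * w t)"
    using inside_unit_circle[OF t] by simp
  then have "0 < (1 - b t)\<^sup>2 * ((q t)\<^sup>2 - 1 - 2 * w t)"
    by (rule le_less_trans[OF zero_le_power2])
  then show pos: "0 < (q t)\<^sup>2 - 1 - 2 * w t"
    by (simp add: zero_less_mult_iff)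
  then have "?n\<^sup>2 < ((1 - b t) * z t)\<^sup>2"
    using less by (simp add: z_def power_mult_distrib)
  moreover have "0 < (1 - b t) * z t"
    using b_less_1[OF t] pos by (simp add: z_def)
  ultimately have "\<bar>?n\<bar> < (1 - b t) * z t"
    by (metis abs_of_pos power2_less_imp_less abs_ge_zero power2_abs order_less_imp_le)
  then show "\<bar>slope t\<bar> < 1"
    using \<open>0 < (1 - b t) * z t\<close> by (simp only: slope_def abs_divide abs_of_pos divide_less_eq_1_pos)
qed

lemma derivative_z:
  assumes t: "t \<in> I"
  shows "(z has_real_derivative
    slope t * ((1 - b t) * (a1 t * b2 t - a2 t * b1 t) / (D t)\<^sup>2)) (at t within I)"
proof -
  let ?\<kappa> = "(a1 t * b2 t - a2 t * b1 t) / (D t)\<^sup>2"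
  let ?r = "\<lambda>t. (q t)\<^sup>2 - 1 - 2 * w t"
  have q: "(q has_real_derivative (1 - b t) * ?\<kappa>) (at t within I)"
    and w: "(w has_real_derivative a t * ?\<kappa>) (at t within I)"
    using derivative_q[OF t] derivative_w[OF t] by simp_all
  have "(?r has_real_derivative 2 * (((1 - b t) * q t - a t) * ?\<kappa>)) (at t within I)"
    by (rule derivative_eq_intros q w refl)+ (simp add: algebra_simps flip: add_divide_distrib diff_divide_distrib)
  from DERIV_chain2[OF DERIV_real_sqrt[OF height_positive[OF t]] this]
  have "(z has_real_derivative
      inverse (z t) / 2 * (2 * (((1 - b t) * q t - a t) * ?\<kappa>))) (at t within I)"
    unfolding z_def .
  moreover have "inverse (z t) / 2 * (2 * (((1 - b t) * q t - a t) * ?\<kappa>)) =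
      slope t * ((1 - b t) * (a1 t * b2 t - a2 t * b1 t) / (D t)\<^sup>2)"
    using b_less_1[OF t] by (auto simp: slope_def divide_simps)
  ultimately show ?thesis
    by (simp only:)
qed

lemma isCont_polar_point:
  assumes "x \<in> S" and "x \<notin> singularity_set S"
  shows "isCont (polar_point G) x"
proof -
  have "isCont G x"
    using FG unfolding smooth_equation_def continuous_on_eq_continuous_at[OF open_UNIV] by blast
  moreover have "G x \<bullet> (x - north_pole) \<noteq> 0"
    using nonsingular_iff[OF FG assms(1)] assms(2) by simp
  ultimately show ?thesis
    unfolding polar_point_def[abs_def] by (intro continuous_intros)
qed

text \<open>
  The sign of \<open>\<sigma>\<close> selects a side of \<open>t\<close>. If \<open>I\<close> ended at \<open>t\<close> on this side, the points of the arc close to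
  \<open>X t\<close> would all lie on one side of its normal at \<open>X t\<close>: since \<open>q\<close> has a continuous inverse and \<open>q s\<close>
  is a continuous function of the point \<open>X s\<close>, they have parameters close to \<open>t\<close>. But \<open>V\<close> is open in
  \<open>S\<close>, and \<open>S\<close> has points in the plane of the arc on the other side.
\<close>

lemma interval_extends:
  fixes \<sigma> :: real
  assumes t: "t \<in> I" and \<sigma>: "\<sigma> \<noteq> 0"
  shows "\<exists>s\<in>I. 0 < \<sigma> * (s - t)"
proof (rule ccontr)
  assume "\<not> ?thesis"
  then have other_side: "\<sigma> * (s - t) \<le> 0" if "s \<in> I" for s
    using that by (auto simp: not_less)
  define T :: "(real^'n) \<times> real" where "T = \<sigma> *\<^sub>R (axis k (a1 t), b1 t)"
  \<comment> \<open>the signed distance from the normal at \<open>X t\<close>, up to a positive factor\<close>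
  define \<phi> where "\<phi> s = (X s - X t) \<bullet> T" for s
  have \<phi>: "\<phi> s = \<sigma> * ((a s - a t) * a1 t + (b s - b t) * b1 t)" for s
    by (simp add: \<phi>_def T_def X_def inner_prod_def inner_diff_left inner_axis_axis algebra_simps)
  have speed: "0 < (a1 t)\<^sup>2 + (b1 t)\<^sup>2"
    using velocity_nonzero[OF t] by (auto simp: sum_power2_gt_zero_iff)
  have T0: "T \<bullet> T = \<sigma>\<^sup>2 * ((a1 t)\<^sup>2 + (b1 t)\<^sup>2)"
    by (simp add: T_def inner_axis_axis power2_eq_square algebra_simps)
  have "T \<bullet> T > 0"
    unfolding T0 using speed \<sigma> by simp
  obtain \<delta> where "\<delta> > 0" and \<delta>: "\<And>s. s \<in> I \<Longrightarrow> \<bar>s - t\<bar> < \<delta> \<Longrightarrow> \<phi> s \<le> 0"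
  proof -
    have "(\<phi> has_real_derivative \<sigma> * ((a1 t)\<^sup>2 + (b1 t)\<^sup>2)) (at t within I)"
      unfolding \<phi>[abs_def]
      by (rule derivative_eq_intros der_a(1)[OF t] der_b(1)[OF t] refl)+
        (simp add: power2_eq_square algebra_simps)
    then have "((\<lambda>s. \<phi> s / (s - t)) \<longlongrightarrow> \<sigma> * ((a1 t)\<^sup>2 + (b1 t)\<^sup>2)) (at t within I)"
      by (simp add: has_field_derivative_iff \<phi>)
    then have "((\<lambda>s. \<sigma> * (\<phi> s / (s - t))) \<longlongrightarrow> \<sigma> * (\<sigma> * ((a1 t)\<^sup>2 + (b1 t)\<^sup>2))) (at t within I)"
      by (intro tendsto_intros)
    moreover have "0 < \<sigma> * (\<sigma> * ((a1 t)\<^sup>2 + (b1 t)\<^sup>2))"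
      using \<open>T \<bullet> T > 0\<close> unfolding T0 by (simp add: power2_eq_square mult.assoc)
    ultimately have "\<forall>\<^sub>F s in at t within I. 0 < \<sigma> * (\<phi> s / (s - t))"
      by (rule order_tendstoD)
    then obtain \<delta> where "\<delta> > 0"
      and \<delta>: "\<And>s. s \<in> I \<Longrightarrow> s \<noteq> t \<Longrightarrow> dist s t < \<delta> \<Longrightarrow> 0 < \<sigma> * (\<phi> s / (s - t))"
      unfolding eventually_at by blast
    show thesis
    proof (rule that[OF \<open>\<delta> > 0\<close>])
      fix s assume s: "s \<in> I" "\<bar>s - t\<bar> < \<delta>"
      show "\<phi> s \<le> 0"
      proof (cases "s = t")
        case False
        have "\<sigma> * (\<phi> s / (s - t)) = (\<sigma> * (s - t)) * (\<phi> s / (s - t)\<^sup>2)"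
          using False by (simp add: power2_eq_square)
        moreover have "(\<sigma> * (s - t)) * (\<phi> s / (s - t)\<^sup>2) \<le> 0" if "0 < \<phi> s"
          using that by (intro mult_nonpos_nonneg[OF other_side[OF s(1)]]) simp
        ultimately show ?thesis
          using \<delta>[OF s(1) False] s(2) by (force simp: dist_real_def)
      qed (simp add: \<phi>)
    qed
  qed
  obtain g where g: "homeomorphism I (q ` I) q g"
    using homeomorphism_into_1d[OF _ continuous_on_q refl inj_on_q] interval(1)
    by (auto simp: is_interval_path_connected)
  then have "continuous_on (q ` I) g" and g_q: "\<And>s. s \<in> I \<Longrightarrow> g (q s) = s"
    by (auto simp: homeomorphism_def)
  then obtain \<eta> where "\<eta> > 0"
    and \<eta>: "\<And>y. y \<in> q ` I \<Longrightarrow> dist y (q t) < \<eta> \<Longrightarrow> dist (g y) (g (q t)) < \<delta>"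
    using t \<open>\<delta> > 0\<close> unfolding continuous_on_iff by blast
  have near: "\<bar>s - t\<bar> < \<delta>" if "s \<in> I" "\<bar>q s - q t\<bar> < \<eta>" for s
    using \<eta>[of "q s"] that t by (simp add: g_q dist_real_def)
  have xS: "X t \<in> S" and ns: "X t \<notin> singularity_set S"
    using X_in_V[OF t] V_subset by auto
  obtain r where "r > 0" and r: "\<And>x. x \<in> S \<Longrightarrow> dist x (X t) < r \<Longrightarrow>
      x \<in> V \<and> \<bar>fst (polar_point G x) $ k - q t\<bar> < \<eta>"
  proof -
    obtain r1 where "r1 > 0" and r1: "\<And>x. x \<in> S \<Longrightarrow> dist x (X t) < r1 \<Longrightarrow> x \<in> V"
      using open_V X_in_V[OF t] unfolding openin_euclidean_subtopology_iff by blast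
    have "isCont (\<lambda>x. fst (polar_point G x) $ k) (X t)"
      by (intro continuous_intros isCont_polar_point xS ns)
    then obtain r2 where "r2 > 0" and r2: "\<And>x. dist x (X t) < r2 \<Longrightarrow>
        dist (fst (polar_point G x) $ k) (fst (polar_point G (X t)) $ k) < \<eta>"
      using \<open>\<eta> > 0\<close> unfolding continuous_at_eps_delta by blast
    show thesis
      by (rule that[of "min r1 r2"])
        (use \<open>r1 > 0\<close> \<open>r2 > 0\<close> r1 r2 polar_point_X(2)[OF t] in \<open>simp_all add: dist_real_def\<close>)
  qed
  have orth: "G (X t) \<bullet> T = 0"
    using polar_point_X(3)[OF t] by (simp only: T_def inner_scaleR_right mult_zero_right)
  obtain d where "d > 0"
    and d: "\<And>s. 0 < s \<Longrightarrow> s < d \<Longrightarrow> \<exists>c. \<bar>c\<bar> \<le> s \<and> X t + s *\<^sub>R T + c *\<^sub>R G (X t) \<in> S"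
    using level_set_points_in_tangent_direction[OF FG xS orth zero_less_one] by auto
  define L where "L = norm T + norm (G (X t))"
  have "L > 0"
    using \<open>T \<bullet> T > 0\<close> by (auto simp: L_def intro!: add_pos_nonneg)
  define s where "s = min (d / 2) (r / (2 * L))"
  have "s > 0" "s < d"
    using \<open>d > 0\<close> \<open>r > 0\<close> \<open>L > 0\<close> by (auto simp: s_def)
  obtain c where c: "\<bar>c\<bar> \<le> s" and yS: "X t + s *\<^sub>R T + c *\<^sub>R G (X t) \<in> S"
    using d[OF \<open>s > 0\<close> \<open>s < d\<close>] by blast
  define y where "y = X t + s *\<^sub>R T + c *\<^sub>R G (X t)"
  have "dist y (X t) \<le> s * norm T + \<bar>c\<bar> * norm (G (X t))"
    using norm_triangle_ineq[of "s *\<^sub>R T" "c *\<^sub>R G (X t)"] \<open>s > 0\<close> by (simp add: y_def dist_norm add.assoc)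
  also have "\<dots> \<le> s * L"
    using c by (simp add: L_def algebra_simps mult_right_mono)
  also have "\<dots> \<le> r / (2 * L) * L"
    using \<open>L > 0\<close> by (intro mult_right_mono) (auto simp: s_def)
  also have "\<dots> < r"
    using \<open>L > 0\<close> \<open>r > 0\<close> by simp
  finally have y: "y \<in> V" "\<bar>fst (polar_point G y) $ k - q t\<bar> < \<eta>"
    using r yS unfolding y_def by blast+
  obtain h where G: "G (X t) = (axis k h, snd (G (X t)))"
    using gradient_in_profile_plane[OF FG sym, of k "a t" "b t"] xS ns unfolding X_def by metis
  have "fst (G (X t)) = axis k h"
    using G by (metis fst_conv)
  then have "fst y = axis k (a t + s * (\<sigma> * a1 t) + c * h)"
    by (simp add: y_def T_def X_def axis_def vec_eq_iff)
  then have "(axis k (a t + s * (\<sigma> * a1 t) + c * h), snd y) \<in> V"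
    using y(1) by (metis prod.collapse)
  then obtain u where u: "u \<in> I" "y = X u"
    using \<open>fst y = _\<close> unfolding arc X_def by (metis prod.collapse)
  then have "\<phi> u \<le> 0"
    using y(2) polar_point_X(2)[OF u(1)] by (intro \<delta> near) simp_all
  moreover have "\<phi> u = s * (T \<bullet> T)"
    using orth by (simp add: \<phi>_def y_def inner_add_left flip: u(2))
  ultimately show False
    using mult_pos_pos[OF \<open>s > 0\<close> \<open>T \<bullet> T > 0\<close>] by linarith
qed

lemma open_I: "open I"
  unfolding open_subopen[of I]
proof
  fix t assume "t \<in> I"
  then obtain s u where "s \<in> I" "s < t" "u \<in> I" "t < u"
    using interval_extends[of t 1] interval_extends[of t "- 1"] by auto
  moreover from this have "{s<..<u} \<subseteq> I"
    using mem_is_interval_1_I[OF interval(1), of s u] by auto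
  ultimately show "\<exists>T. open T \<and> t \<in> T \<and> T \<subseteq> I"
    by (intro exI[of _ "{s<..<u}"]) auto
qed

text \<open>
  Along a sequence on which \<open>q\<close> converges, polarity and compactness of \<open>S\<close> in the open ball force
  \<open>w\<close> to converge as well (for a subsequence). So the poles stay bounded, and the limit point is
  not singular, since the pole tends to infinity at the singularity set.
\<close>

lemma closed_range_q: "closed (q ` I)"
proof (subst closed_sequential_limits, intro allI impI, elim conjE)
  fix qs l assume "\<forall>n. qs n \<in> q ` I" and lim: "qs \<longlonglongrightarrow> l"
  then obtain \<tau> where \<tau>: "\<And>n. \<tau> n \<in> I" "\<And>n. qs n = q (\<tau> n)"
    unfolding image_iff by metis
  have "\<forall>n. X (\<tau> n) \<in> S"
    using X_in_V \<tau>(1) V_subset(1) by blast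
  with compact_imp_seq_compact[OF compact]
  obtain y r where "y \<in> S" "strict_mono r" and y: "((\<lambda>n. X (\<tau> n)) \<circ> r) \<longlonglongrightarrow> y"
    by (rule seq_compactE)
  define s where "s n = \<tau> (r n)" for n
  have s: "s n \<in> I" for n
    by (simp add: s_def \<tau>)
  have X_s: "(\<lambda>n. X (s n)) \<longlonglongrightarrow> y"
    using y by (simp add: s_def o_def)
  have q_s: "(\<lambda>n. q (s n)) \<longlonglongrightarrow> l"
    using LIMSEQ_subseq_LIMSEQ[OF lim \<open>strict_mono r\<close>] by (simp add: o_def s_def \<tau>(2))
  have a_s: "(\<lambda>n. a (s n)) \<longlonglongrightarrow> fst y $ k" and b_s: "(\<lambda>n. b (s n)) \<longlonglongrightarrow> snd y"
    using tendsto_vec_nth[OF tendsto_fst[OF X_s], of k] tendsto_snd[OF X_s]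
    by (simp_all add: X_def)
  have "norm y < 1"
    using \<open>y \<in> S\<close> ball by auto
  then have "1 - snd y \<noteq> 0"
    using norm_snd_le[of "snd y" "fst y"] by auto
  \<comment> \<open>the limit of \<open>w\<close> forced by \<open>polarity\<close>\<close>
  define w0 where "w0 = (l * (fst y $ k) - 1) / (1 - snd y)"
  have "w t = (q t * a t - 1) / (1 - b t)" if "t \<in> I" for t
    using polarity[OF that] b_less_1[OF that] by (simp add: field_simps)
  moreover have "(\<lambda>n. (q (s n) * a (s n) - 1) / (1 - b (s n))) \<longlonglongrightarrow> w0"
    unfolding w0_def using \<open>1 - snd y \<noteq> 0\<close> by (intro tendsto_intros q_s a_s b_s)
  ultimately have w_s: "(\<lambda>n. w (s n)) \<longlonglongrightarrow> w0"
    using s by simp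
  define W where "W = (axis k l :: real^'n, w0)"
  have "(\<lambda>n. axis k (q (s n)) :: real^'n) \<longlonglongrightarrow> axis k l"
    by (rule vec_tendstoI) (auto simp: axis_def q_s)
  then have W_s: "(\<lambda>n. polar_point G (X (s n))) \<longlonglongrightarrow> W"
    unfolding W_def polar_point_X(2)[OF s] by (intro tendsto_Pair w_s)
  let ?d = "\<lambda>x. G x \<bullet> (x - north_pole)"
  have "isCont G y"
    using FG unfolding smooth_equation_def continuous_on_eq_continuous_at[OF open_UNIV] by blast
  then have G_s: "(\<lambda>n. G (X (s n))) \<longlonglongrightarrow> G y"
    by (rule isCont_tendsto_compose[OF _ X_s])
  then have "(\<lambda>n. ?d (X (s n)) *\<^sub>R polar_point G (X (s n))) \<longlonglongrightarrow> ?d y *\<^sub>R W"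
    by (intro tendsto_intros W_s X_s)
  moreover have "?d (X (s n)) *\<^sub>R polar_point G (X (s n)) = G (X (s n))" for n
  proof -
    have "?d (X (s n)) \<noteq> 0"
      using nonsingular_iff[OF FG] X_in_V[OF s] V_subset by blast
    then show ?thesis
      by (simp add: polar_point_def)
  qed
  ultimately have G_y: "G y = ?d y *\<^sub>R W"
    using G_s LIMSEQ_unique by (metis (no_types, lifting) LIMSEQ_unique ext)
  moreover have "G y \<noteq> 0"
    using FG \<open>y \<in> S\<close> by (auto simp: smooth_equation_def)
  ultimately have "?d y \<noteq> 0"
    by auto
  then have W: "W = polar_point G y"
    using arg_cong[OF G_y, of "\<lambda>v. v /\<^sub>R ?d y"] by (simp add: polar_point_def)
  have "y \<in> S - singularity_set S"
    using nonsingular_iff[OF FG \<open>y \<in> S\<close>] \<open>?d y \<noteq> 0\<close> \<open>y \<in> S\<close> by simp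
  moreover obtain C where "closed C" and C: "V = (S - singularity_set S) \<inter> C"
    using closedin_component[OF component] unfolding closedin_closed by blast
  moreover have "y \<in> C"
  proof (rule closed_sequentially[OF \<open>closed C\<close> _ X_s])
    show "X (s n) \<in> C" for n
      using X_in_V[OF s] C by blast
  qed
  ultimately have "y \<in> V"
    by blast
  moreover have "fst y = axis k (fst y $ k)"
  proof -
    have "fst y $ j = 0" if "j \<noteq> k" for j
    proof -
      have "(\<lambda>n. fst (X (s n)) $ j) \<longlonglongrightarrow> fst y $ j"
        by (intro tendsto_intros X_s)
      moreover have "fst (X (s n)) $ j = 0" for n
        using that by (simp add: X_def axis_def)
      ultimately show ?thesis
        by (simp add: LIMSEQ_const_iff)
    qed
    then show ?thesis
      by (simp add: vec_eq_iff axis_def)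
  qed
  ultimately have "(axis k (fst y $ k), snd y) \<in> V"
    by (metis prod.collapse)
  then obtain t where t: "t \<in> I" "y = X t"
    using \<open>fst y = _\<close> unfolding arc X_def by (metis prod.collapse)
  have "axis k l = (axis k (q t) :: real^'n)"
    using W polar_point_X(2)[OF t(1)] by (simp add: W_def t(2))
  then have "l = q t"
    by (auto simp: axis_eq_axis)
  then show "l \<in> q ` I"
    using t(1) by blast
qed

lemma range_q: "q ` I = UNIV"
proof -
  have "open (q ` I)"
    by (rule injective_into_1d_imp_open_map_UNIV[OF open_I continuous_on_q inj_on_q order_refl])
  moreover have "q ` I \<noteq> {}"
    using interval(2) interior_subset by fastforce
  ultimately show ?thesis
    using closed_range_q clopen[of "q ` I"] by blast
qed

lemma surface_map_X:
  assumes "t \<in> I"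
  shows "surface_map S (X t) = (axis k (q t), z t)"
proof -
  have "surface_map S (X t) = lift_polar (polar_point G (X t))"
    using surface_map_eq[OF FG] X_in_V[OF assms] V_subset by blast
  then show ?thesis
    by (simp add: polar_point_X(2)[OF assms] lift_polar_def z_def norm_axis)
qed

lemma image_of_arc_is_graph:
  obtains f f' where "\<And>t. t \<in> I \<Longrightarrow> z t = f (q t)"
    "\<And>s. (f has_real_derivative f' s) (at s)" "continuous_on UNIV f'" "\<And>s. \<bar>f' s\<bar> < 1"
proof -
  have at: "at t within I = at t" if "t \<in> I" for t
    using open_I that by (rule at_within_open[rotated])
  have "continuous_on I z"
    using derivative_z by (rule DERIV_continuous_on)
  moreover have "continuous_on I a" "continuous_on I b"
    using der_a(1) der_b(1) by (auto intro: DERIV_continuous_on)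
  moreover have "(1 - b t) * z t \<noteq> 0" if "t \<in> I" for t
    using b_less_1[OF that] height_positive[OF that] by (simp add: z_def)
  ultimately have cont_slope: "continuous_on I slope"
    unfolding slope_def[abs_def] by (intro continuous_intros continuous_on_q) auto
  let ?q' = "\<lambda>t. (1 - b t) * (a1 t * b2 t - a2 t * b1 t) / (D t)\<^sup>2"
  have dq: "(q has_real_derivative ?q' t) (at t)" if "t \<in> I" for t
    using derivative_q[OF that] unfolding at[OF that] .
  have dz: "(z has_real_derivative slope t * ?q' t) (at t)" if "t \<in> I" for t
    using derivative_z[OF that] unfolding at[OF that] .
  obtain f f' where f: "\<And>t. t \<in> I \<Longrightarrow> f (q t) = z t"
    and f': "\<And>t. t \<in> I \<Longrightarrow> f' (q t) = slope t"
    and der: "\<And>s. (f has_real_derivative f' s) (at s)" and cont: "continuous_on UNIV f'"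
  proof -
    show thesis
      by (rule continuously_differentiable_reparametrization
          [where q' = ?q' and z = z and m = slope, OF open_I interval(1) inj_on_q range_q])
        (fact dq derivative_q_nonzero dz cont_slope that)+
  qed
  have "\<bar>f' s\<bar> < 1" for s
  proof -
    obtain t where "t \<in> I" "s = q t"
      using range_q by (metis UNIV_I imageE)
    then show ?thesis
      using f' slope_less_1 by simp
  qed
  with f der cont show thesis
    by (intro that[of f f']) auto
qed

text \<open>Hence the image of \<open>V\<close> is axially symmetric and determined by the image of the arc.\<close>

lemma surface_map_axial_map:
  assumes A: "rotation_matrix A" and x: "x \<in> V"
  shows "surface_map S (axial_map A x) = axial_map A (surface_map S x)"
proof -
  have "axial_map A x \<in> V"
    using sym_V A x unfolding axially_symmetric_def by blast
  then have "surface_map S (axial_map A x) = lift_polar (polar_point G (axial_map A x))"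
    using surface_map_eq[OF FG] V_subset by blast
  also have "\<dots> = lift_polar (axial_map A (polar_point G x))"
    using polar_point_axial_map[OF FG sym A, of x] V_subset(1) x by (metis subsetD)
  also have "\<dots> = axial_map A (lift_polar (polar_point G x))"
  proof -
    have "norm (A *v v) = norm v" for v
      using A by (simp add: rotation_matrix_def orthogonal_transformation_matrix
          orthogonal_transformation_norm)
    then show ?thesis
      by (simp add: lift_polar_def axial_map_def)
  qed
  also have "lift_polar (polar_point G x) = surface_map S x"
    using surface_map_eq[OF FG] x V_subset by (metis subsetD)
  finally show ?thesis .
qed

text \<open>
  A rotation that maps \<open>e\<^sub>k\<close> to \<open>-e\<^sub>k\<close> preserves \<open>V\<close>, and reflects the plane of the arc in the axis. This
  is what makes the graph even.
\<close>

lemma arc_mirror_symmetric: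
  assumes n2: "2 \<le> CARD('n)" and t: "t \<in> I"
  obtains s where "s \<in> I" "q s = - q t" "z s = z t"
proof -
  obtain A where A: "rotation_matrix A" "A *v axis k 1 = (axis k (- 1) :: real^'n)"
    using rotation_matrix_maps_to[OF n2, of "axis k 1" "axis k (- 1)"] by (auto simp: norm_axis)
  have mirror: "A *v axis k u = axis k (- u)" for u
  proof -
    have "A *v axis k u = A *v (u *\<^sub>R axis k 1)"
      by (rule arg_cong[of _ _ "\<lambda>v. A *v v"]) (simp add: axis_def vec_eq_iff)
    also have "\<dots> = u *\<^sub>R axis k (- 1)"
      by (simp add: matrix_vector_mult_scaleR A(2))
    also have "\<dots> = axis k (- u)"
      by (simp add: axis_def vec_eq_iff)
    finally show ?thesis .
  qed
  have Xt: "X t \<in> V"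
    by (rule X_in_V[OF t])
  have "axial_map A (X t) \<in> V"
    using sym_V A(1) Xt unfolding axially_symmetric_def by blast
  then obtain s where s: "s \<in> I" "axial_map A (X t) = X s"
    by (auto simp: X_def axial_map_def mirror arc)
  have "surface_map S (X s) = axial_map A (surface_map S (X t))"
    using surface_map_axial_map[OF A(1) Xt] by (simp add: s(2))
  then have "(axis k (q s), z s) = (axis k (- q t) :: real^'n, z t)"
    by (simp add: surface_map_X s(1) t axial_map_def mirror)
  then show thesis
    using that[OF s(1)] by (auto simp: axis_eq_axis)
qed

lemma space_like_image:
  assumes rev: "\<And>x. x \<in> V \<Longrightarrow> \<exists>A. rotation_matrix A \<and> x \<in> axial_map A ` X ` I"
  shows "space_like (surface_map S ` V)"
proof -
  obtain f f' where f: "\<And>t. t \<in> I \<Longrightarrow> z t = f (q t)"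
    and der: "\<And>s. (f has_real_derivative f' s) (at s)"
    and cont: "continuous_on UNIV f'" and less: "\<And>s. \<bar>f' s\<bar> < 1"
  proof -
    show thesis
      by (rule image_of_arc_is_graph) (fact that)
  qed
  have param: "\<exists>t\<in>I. q t = s" for s
    using range_q by (metis UNIV_I imageE)
  show ?thesis
  proof (cases "2 \<le> CARD('n)")
    case False
    then have "card (UNIV :: 'n set) = 1"
      using zero_less_card_finite[where 'a='n] by linarith
    then have "\<And>j. j = k"
      by (metis UNIV_I card_1_singletonE singletonD)
    then have coord: "v = axis k (v $ k)" for v :: "real^'n"
      by (metis axis_nth vec_eq_iff)
    have "surface_map S ` V = {(v, y). y = f (v $ k)}"
    proof (intro equalityI subsetI)
      fix p assume "p \<in> surface_map S ` V"
      then obtain x where "x \<in> V" "p = surface_map S x"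
        by blast
      moreover have "x = (axis k (fst x $ k), snd x)"
        using coord by (metis prod.collapse)
      ultimately obtain t where "t \<in> I" "p = surface_map S (X t)"
        unfolding X_def by (metis arc)
      then show "p \<in> {(v, y). y = f (v $ k)}"
        by (simp add: surface_map_X f)
    next
      fix p assume "p \<in> {(v, y). y = f (v $ k)}"
      then obtain v where p: "p = (v, f (v $ k))"
        by auto
      obtain t where t: "t \<in> I" "q t = v $ k"
        using param by blast
      then have "p = surface_map S (X t)"
        using coord[of v] by (simp add: p surface_map_X f)
      then show "p \<in> surface_map S ` V"
        using X_in_V[OF t(1)] by blast
    qed
    moreover have "space_like {(v, y). y = f (v $ k)}"
    proof (rule space_like_graph)
      have "GDERIV (\<lambda>v. v $ k) v :> axis k 1" for v :: "real^'n"
        by (simp add: gderiv_def inner_axis bounded_linear_imp_has_derivative bounded_linear_vec_nth)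
      then show "GDERIV (\<lambda>v. f (v $ k)) v :> f' (v $ k) *\<^sub>R axis k 1" for v :: "real^'n"
        by (rule GDERIV_DERIV_compose[OF _ der])
      show "continuous_on UNIV (\<lambda>v::real^'n. f' (v $ k) *\<^sub>R (axis k 1 :: real^'n))"
        by (intro continuous_intros continuous_on_compose2[OF cont]) auto
      show "norm (f' (v $ k) *\<^sub>R (axis k 1 :: real^'n)) \<le> 1" for v :: "real^'n"
        using less[of "v $ k"] by (simp add: norm_axis)
    qed
    ultimately show ?thesis
      by simp
  next
    case n2: True
    have even: "f (- s) = f s" for s
    proof -
      obtain t where t: "t \<in> I" "q t = s"
        using param by blast
      then show ?thesis
        using arc_mirror_symmetric[OF n2 t(1)] f by metis
    qed
    have "surface_map S ` V = {(v, y). y = f (norm v)}"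
    proof (intro equalityI subsetI)
      fix p assume "p \<in> surface_map S ` V"
      then obtain A t where A: "rotation_matrix A" and t: "t \<in> I"
        and p: "p = surface_map S (axial_map A (X t))"
        using rev by blast
      have "p = (A *v axis k (q t), f (q t))"
        using surface_map_axial_map[OF A X_in_V[OF t]]
        by (simp add: p surface_map_X[OF t] axial_map_def f[OF t])
      moreover have "norm (A *v axis k (q t)) = \<bar>q t\<bar>"
        using A by (simp add: rotation_matrix_def orthogonal_transformation_matrix
            orthogonal_transformation_norm norm_axis)
      moreover have "f \<bar>q t\<bar> = f (q t)"
        using even by (simp add: abs_if)
      ultimately show "p \<in> {(v, y). y = f (norm v)}"
        by simp
    next
      fix p :: "(real^'n) \<times> real"
      assume "p \<in> {(v, y). y = f (norm v)}"
      then obtain v :: "real^'n" where p: "p = (v, f (norm v))"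
        by auto
      obtain t where t: "t \<in> I" "q t = norm v"
        using param by blast
      obtain A where A: "rotation_matrix A" "A *v axis k (norm v) = v"
        using rotation_matrix_maps_to[OF n2, of "axis k (norm v)" v] by (auto simp: norm_axis)
      have "p = surface_map S (axial_map A (X t))"
        using surface_map_axial_map[OF A(1) X_in_V[OF t(1)]]
        by (simp add: p surface_map_X[OF t(1)] axial_map_def f[OF t(1)] t(2) A(2))
      moreover have "axial_map A (X t) \<in> V"
        using sym_V A(1) X_in_V[OF t(1)] unfolding axially_symmetric_def by blast
      ultimately show "p \<in> surface_map S ` V"
        by blast
    qed
    moreover have "space_like {(v :: real^'n, y). y = f (norm v)}"
    proof (rule space_like_graph)
      show "GDERIV (\<lambda>v. f (norm v)) v :> (f' (norm v) / norm v) *\<^sub>R v" for v :: "real^'n"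
        by (rule gderiv_even_function_of_norm(2)[OF der even])
      show "continuous_on UNIV (\<lambda>v::real^'n. (f' (norm v) / norm v) *\<^sub>R v)"
        by (rule continuous_radial_field[OF cont gderiv_even_function_of_norm(1)[OF der even]])
      show "norm ((f' (norm v) / norm v) *\<^sub>R v) \<le> 1" for v :: "real^'n"
        using less[of "norm v"] by (cases "v = 0") auto
    qed
    ultimately show ?thesis
      by simp
  qed
qed

end

section \<open>The image of a regular component\<close>

theorem theorem3p6:
  fixes \<Sigma> V :: "((real^'n) \<times> real) set" and k :: 'n
  assumes "smooth_hypersurface \<Sigma>"
    and "compact \<Sigma>"
    and "axially_symmetric \<Sigma>"
    and "simply_connected (inside \<Sigma>)"
    and "\<Sigma> \<subseteq> ball 0 1"
    and "V \<in> components (\<Sigma> - singularity_set \<Sigma>)"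
    and "simply_connected V"
    and "regular_subdomain k \<Sigma> V"
  shows "space_like (surface_map \<Sigma> ` V)"
proof -
  obtain F G where FG: "smooth_equation F G \<Sigma>"
    using assms(1) by (auto simp: smooth_hypersurface_def)
  have V: "openin (top_of_set \<Sigma>) V" "axially_symmetric V" "V = surface_of_revolution k (profile k V)"
    and "regular_subcurve (profile k \<Sigma>) (profile k V)"
    using assms(8) by (auto simp: regular_subdomain_def)
  then obtain I \<gamma> \<gamma>' \<gamma>'' where I: "is_interval I" "interior I \<noteq> {}" and image: "\<gamma> ` I = profile k V"
    and der: "\<forall>t\<in>I. (\<gamma> has_vector_derivative \<gamma>' t) (at t within I)"
      "\<forall>t\<in>I. (\<gamma>' has_vector_derivative \<gamma>'' t) (at t within I)"
    and curv: "\<forall>t\<in>I. \<gamma>' t $ 1 * \<gamma>'' t $ 2 - \<gamma>'' t $ 1 * \<gamma>' t $ 2 \<noteq> 0"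
    unfolding regular_subcurve_def by (elim conjE exE) (rule that)
  have component: "((\<lambda>t. c t $ i) has_real_derivative d $ i) (at t within I)"
    if "(c has_vector_derivative d) (at t within I)" for c :: "real \<Rightarrow> real^2" and d i t
    using bounded_linear.has_vector_derivative[OF bounded_linear_vec_nth that]
    by (simp add: has_real_derivative_iff_has_vector_derivative)
  have arc: "(axis k u, v) \<in> V \<longleftrightarrow> (\<exists>t\<in>I. u = \<gamma> t $ 1 \<and> v = \<gamma> t $ 2)" for u v
  proof -
    have "(axis k u, v) \<in> V \<longleftrightarrow> vector [u, v] \<in> profile k V"
      by (simp add: profile_def plane_embedding_def)
    also have "\<dots> \<longleftrightarrow> (\<exists>t\<in>I. vector [u, v] = \<gamma> t)"
      unfolding image[symmetric] by blast
    finally show ?thesis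
      by (simp add: vec_eq_iff forall_2)
  qed
  interpret generating_arc F G \<Sigma> V k I "\<lambda>t. \<gamma> t $ 1" "\<lambda>t. \<gamma>' t $ 1" "\<lambda>t. \<gamma>'' t $ 1"
    "\<lambda>t. \<gamma> t $ 2" "\<lambda>t. \<gamma>' t $ 2" "\<lambda>t. \<gamma>'' t $ 2"
  proof (unfold_locales)
    show "smooth_equation F G \<Sigma>" "compact \<Sigma>" "\<Sigma> \<subseteq> ball 0 1" "axially_symmetric \<Sigma>"
      "axially_symmetric V" "V \<in> components (\<Sigma> - singularity_set \<Sigma>)" "openin (top_of_set \<Sigma>) V"
      "is_interval I" "interior I \<noteq> {}"
      by (fact FG assms V I)+
  qed (fact arc component[OF der(1)[rule_format]]
      component[OF der(2)[rule_format]] curv[rule_format])+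
  show ?thesis
  proof (rule space_like_image)
    have X: "plane_embedding k ` profile k V = X ` I"
      by (simp add: X_def plane_embedding_def image_image flip: image)
    fix x assume "x \<in> V"
    then have "x \<in> surface_of_revolution k (profile k V)"
      using V(3) by simp
    then show "\<exists>A. rotation_matrix A \<and> x \<in> axial_map A ` X ` I"
      unfolding surface_of_revolution_def X by simp
  qed
qed

end
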